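(* Let $\mathbf{k}$ be a field of characteristic zero, let $S$ be an affine, saturated, pointed semigroup minimally embedded in $M\cong\mathbb{Z}^n$, and let $I=(\mathbf{x}^{\mathbf{a}_1},\dots,\mathbf{x}^{\mathbf{a}_l})\subset\mathbf{k}[S]$ with $\mathbf{a}_i\in S$. Then $$\mathfrak{s}(I)=\bigoplus_{\alpha\in\mathcal{R}(I)}\mathfrak{s}_\alpha.$$ In particular, $\operatorname{Der}_I(\mathbf{k}[S])=\mathfrak{g}\oplus\mathfrak{s}(I)$.
   Context: An affine semigroup $S$ is a finitely generated commutative semigroup with identity embeddable in a lattice; it is minimally embedded in $M\cong\mathbb{Z}^n$ if it generates $M$ as a group. With $\omega_S\subset M\otimes\mathbb{R}$ the cone spanned by $S$, $S$ is saturated if $\omega_S\cap M=S$ and pointed if $\omega_S$ contains no nonzero vector space. Let $N=\operatorname{Hom}(M,\mathbb{Z})$ and $N_{\mathbf{k}}=N\otimes_{\mathbb{Z}}\mathbf{k}$; elements $p\in N_{\mathbf{k}}$ are viewed as homomorphisms $M\to\mathbf{k}$, and $p^\perp=\{m\in M\mid p(m)=0\}$. $\mathbf{k}[S]=\bigoplus_{m\in S}\mathbf{k}\cdot\mathbf{x}^m$ with $\mathbf{x}^m\mathbf{x}^{m'}=\mathbf{x}^{m+m'}$, $\mathbf{x}^0=1$; $\operatorname{supp}(I)=\{m\in S\mid\mathbf{x}^m\in I\}$. $\operatorname{Der}_I(\mathbf{k}[S])$ is the space of $\mathbf{k}$-derivations $\partial$ of $\mathbf{k}[S]$ with $\partial(I)\subset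 I$. For $\alpha\in M$, $p\in N_{\mathbf{k}}$, write $\partial_{\alpha,p}$ for the map $\mathbf{x}^m\mapsto p(m)\mathbf{x}^{m+\alpha}$. The dual semigroup is $S^\vee=\{p\in N\mid p(m)\ge 0\text{ for all }m\in S\}$. A face of a semigroup is a subsemigroup $S'$ such that $m+m'\in S'$ implies $m,m'\in S'$; a ray is a face isomorphic to $\mathbb{Z}_{\ge 0}$; $S^\vee(1)$ is the set of the generators of the rays of $S^\vee$. For $\rho\in S^\vee(1)$ let $$\mathcal{R}_\rho=\{\alpha\in M\mid\rho(\alpha)=-1,\ \rho'(\alpha)\ge 0\text{ for all }\rho'\in S^\vee(1)\setminus\{\rho\}\},\qquad \mathcal{R}=\bigcup_{\rho\in S^\vee(1)}\mathcal{R}_\rho$$ (the sets $\mathcal{R}_\rho$ are pairwise disjoint), and $$\mathcal{R}_\rho(I)=\{\alpha\in\mathcal{R}_\rho\mid\mathbf{a}_i+\alpha\in\operatorname{supp}(I)\text{ for all }\mathbf{a}_i\notin\rho^\perp\},\qquad\mathcal{R}(I)=\bigcup_{\rho\in S^\vee(1)}\mathcal{R}_\rho(I).$$ Define $\mathfrak{g}=\bigoplus_{\alpha\in S}\mathfrak{g}_\alpha$ with $\mathfrak{g}_\alpha=\{\partial_{\alpha,p}\mid p\in N_{\mathbf{k}}\}$, and $\mathfrak{s}=\bigoplus_{\alpha\in\mathcal{R}}\mathfrak{s}_\alpha$ with $\mathfrak{s}_\alpha=\{\partial_{\alpha,\lambda\rho}\mid\lambda\in\mathbf{k}\}$, where $\rho\in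 S^\vee(1)$ is the element with $\alpha\in\mathcal{R}_\rho$. Both are subspaces of $\operatorname{Der}(\mathbf{k}[S])$. Finally $\mathfrak{s}(I)=\{\partial\in\mathfrak{s}\mid\partial(I)\subset I\}$. *)

theory Defs
  imports "HOL-Analysis.Convex" "HOL-Library.Poly_Mapping" "HOL-Library.Function_Algebras"
begin

section \<open>The lattice and affine semigroups\<close>

text \<open>
  The lattice \<open>M\<close> is a whole type \<open>'m\<close> that is isomorphic (via \<open>\<phi>\<close>) to the group of integer
  vectors with coordinates \<open>0, \<dots>, n - 1\<close>; \<open>n = 0\<close> is allowed.  The map \<open>\<iota>\<close> embeds \<open>M\<close> into
  a real vector space, sending the standard lattice basis to linearly independent vectors
  \<open>e 0, \<dots>, e (n - 1)\<close>.  Hence the real span of \<open>range \<iota>\<close> is \<open>M \<otimes> \<real>\<close>, and \<open>\<iota>\<close> is \<open>m \<mapsto> m \<otimes> 1\<close>.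
\<close>

definition lattice_embedding :: "nat \<Rightarrow> ('m::ab_group_add \<Rightarrow> 'v::real_vector) \<Rightarrow> bool" where
  "lattice_embedding n \<iota> \<longleftrightarrow>
     (\<exists>(\<phi> :: 'm \<Rightarrow> nat \<Rightarrow> int) (e :: nat \<Rightarrow> 'v).
        (\<forall>x y. \<phi> (x + y) = \<phi> x + \<phi> y) \<and>
        bij_betw \<phi> UNIV {v. \<forall>i\<ge>n. v i = 0} \<and>
        inj_on e {..<n} \<and> independent (e ` {..<n}) \<and>
        (\<forall>m. \<iota> m = (\<Sum>i<n. of_int (\<phi> m i) *\<^sub>R e i)))"

definition submonoid :: "'a::comm_monoid_add set \<Rightarrow> bool" where
  "submonoid T \<longleftrightarrow> 0 \<in> T \<and> (\<forall>x\<in>T. \<forall>y\<in>T. x + y \<in> T)"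

definition subgroup_of :: "'m::ab_group_add set \<Rightarrow> bool" where
  "subgroup_of T \<longleftrightarrow> submonoid T \<and> (\<forall>x\<in>T. - x \<in> T)"

definition affine_semigroup :: "'m::ab_group_add set \<Rightarrow> bool" where
  "affine_semigroup S \<longleftrightarrow> (\<exists>G. finite G \<and> S = submonoid hull G)"

definition minimally_embedded :: "'m::ab_group_add set \<Rightarrow> bool" where
  "minimally_embedded S \<longleftrightarrow> subgroup_of hull S = UNIV"

definition cone_of :: "('m \<Rightarrow> 'v::real_vector) \<Rightarrow> 'm set \<Rightarrow> 'v set" where
  "cone_of \<iota> S = convex_cone hull (\<iota> ` S)"

definition saturated :: "('m \<Rightarrow> 'v::real_vector) \<Rightarrow> 'm set \<Rightarrow> bool" where
  "saturated \<iota> S \<longleftrightarrow> {m. \<iota> m \<in> cone_of \<iota> S} = S"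

definition pointed :: "('m \<Rightarrow> 'v::real_vector) \<Rightarrow> 'm set \<Rightarrow> bool" where
  "pointed \<iota> S \<longleftrightarrow> (\<forall>V. subspace V \<and> V \<subseteq> cone_of \<iota> S \<longrightarrow> V = {0})"

section \<open>The dual lattice, the dual semigroup and its rays\<close>

definition dual_lattice :: "('m::ab_group_add \<Rightarrow> int) set" where
  "dual_lattice = {p. additive p}"

text \<open>
  \<open>N \<otimes> \<k>\<close>, viewed inside \<open>Hom(M, \<k>)\<close>: the elements \<open>\<Sum>q. q \<otimes> c q\<close> act by \<open>m \<mapsto> \<Sum>q. c q * q m\<close>.
  (As \<open>M\<close> is free of finite rank, \<open>N \<otimes> \<k> \<rightarrow> Hom(M, \<k>)\<close> is injective.)
\<close>

definition dual_lattice_over :: "('m::ab_group_add \<Rightarrow> 'k::field_char_0) set" where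
  "dual_lattice_over =
     {(\<lambda>m. \<Sum>q\<in>F. c q * of_int (q m)) | F c. finite F \<and> F \<subseteq> dual_lattice}"

definition perp :: "('m \<Rightarrow> 'b::zero) \<Rightarrow> 'm set" where
  "perp p = {m. p m = 0}"

definition dual_semigroup :: "'m::ab_group_add set \<Rightarrow> ('m \<Rightarrow> int) set" where
  "dual_semigroup S = {p \<in> dual_lattice. \<forall>m\<in>S. p m \<ge> 0}"

definition semigroup_face :: "'a::comm_monoid_add set \<Rightarrow> 'a set \<Rightarrow> bool" where
  "semigroup_face F T \<longleftrightarrow>
     F \<subseteq> T \<and> submonoid F \<and> (\<forall>x\<in>T. \<forall>y\<in>T. x + y \<in> F \<longrightarrow> x \<in> F \<and> y \<in> F)"

definition semigroup_ray :: "'a::comm_monoid_add set \<Rightarrow> 'a set \<Rightarrow> bool" where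
  "semigroup_ray F T \<longleftrightarrow> semigroup_face F T \<and>
     (\<exists>\<psi> :: nat \<Rightarrow> 'a. bij_betw \<psi> UNIV F \<and> (\<forall>a b. \<psi> (a + b) = \<psi> a + \<psi> b))"

definition dual_rays :: "'m::ab_group_add set \<Rightarrow> ('m \<Rightarrow> int) set" where
  "dual_rays S = {\<rho>. \<exists>F. semigroup_ray F (dual_semigroup S) \<and> F = submonoid hull {\<rho>}}"

definition roots_of :: "'m::ab_group_add set \<Rightarrow> ('m \<Rightarrow> int) \<Rightarrow> 'm set" where
  "roots_of S \<rho> = {\<alpha>. \<rho> \<alpha> = -1 \<and> (\<forall>\<rho>'\<in>dual_rays S - {\<rho>}. \<rho>' \<alpha> \<ge> 0)}"

definition roots :: "'m::ab_group_add set \<Rightarrow> 'm set" where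
  "roots S = (\<Union>\<rho>\<in>dual_rays S. roots_of S \<rho>)"

definition root_ray :: "'m::ab_group_add set \<Rightarrow> 'm \<Rightarrow> ('m \<Rightarrow> int)" where
  "root_ray S \<alpha> = (THE \<rho>. \<rho> \<in> dual_rays S \<and> \<alpha> \<in> roots_of S \<rho>)"

lemma root_ray_eq:
  assumes "\<rho> \<in> dual_rays S" "\<alpha> \<in> roots_of S \<rho>"
  shows "root_ray S \<alpha> = \<rho>"
  unfolding root_ray_def
proof (rule the_equality)
  fix \<rho>' assume "\<rho>' \<in> dual_rays S \<and> \<alpha> \<in> roots_of S \<rho>'"
  with assms show "\<rho>' = \<rho>" unfolding roots_of_def by force
qed (use assms in auto)

section \<open>The semigroup algebra, monomial ideals and derivations\<close>

text \<open>
  \<open>\<k>[M]\<close> is \<open>'m \<Rightarrow>\<^sub>0 'k\<close> with the convolution product; \<open>\<k>[S]\<close> is the subalgebra of elements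
  supported in \<open>S\<close>.
\<close>

definition semigroup_algebra :: "'m::ab_group_add set \<Rightarrow> ('m \<Rightarrow>\<^sub>0 'k::field_char_0) set" where
  "semigroup_algebra S = {f. Poly_Mapping.keys f \<subseteq> S}"

abbreviation monom_x :: "'m::ab_group_add \<Rightarrow> ('m \<Rightarrow>\<^sub>0 'k::field_char_0)" where
  "monom_x m \<equiv> Poly_Mapping.single m 1"

definition scal :: "'k::field_char_0 \<Rightarrow> ('m::ab_group_add \<Rightarrow>\<^sub>0 'k) \<Rightarrow> ('m \<Rightarrow>\<^sub>0 'k)" where
  "scal c f = Poly_Mapping.single 0 c * f"

definition ideal_of :: "'m::ab_group_add set \<Rightarrow> ('m \<Rightarrow>\<^sub>0 'k::field_char_0) set \<Rightarrow> bool" where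
  "ideal_of S J \<longleftrightarrow> J \<subseteq> semigroup_algebra S \<and> submonoid J \<and>
     (\<forall>f\<in>semigroup_algebra S. \<forall>g\<in>J. f * g \<in> J)"

definition monomial_ideal ::
    "'m::ab_group_add set \<Rightarrow> nat \<Rightarrow> (nat \<Rightarrow> 'm) \<Rightarrow> ('m \<Rightarrow>\<^sub>0 'k::field_char_0) set" where
  "monomial_ideal S l a = ideal_of S hull ((\<lambda>i. monom_x (a i)) ` {1..l})"

definition supp :: "'m::ab_group_add set \<Rightarrow> ('m \<Rightarrow>\<^sub>0 'k::field_char_0) set \<Rightarrow> 'm set" where
  "supp S I = {m \<in> S. monom_x m \<in> I}"

type_synonym ('m, 'k) operator = "('m \<Rightarrow>\<^sub>0 'k) \<Rightarrow> ('m \<Rightarrow>\<^sub>0 'k)"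

text \<open>
  Maps with domain \<open>\<k>[S]\<close> are represented by functions on \<open>\<k>[M]\<close> that vanish outside \<open>\<k>[S]\<close>;
  this makes the representation unique and compatible with pointwise addition and scaling.
\<close>

definition derivations :: "'m::ab_group_add set \<Rightarrow> ('m, 'k::field_char_0) operator set" where
  "derivations S = {D.
     (\<forall>f. f \<notin> semigroup_algebra S \<longrightarrow> D f = 0) \<and>
     (\<forall>f\<in>semigroup_algebra S. D f \<in> semigroup_algebra S) \<and>
     (\<forall>f\<in>semigroup_algebra S. \<forall>g\<in>semigroup_algebra S. D (f + g) = D f + D g) \<and>
     (\<forall>c. \<forall>f\<in>semigroup_algebra S. D (scal c f) = scal c (D f)) \<and>
     (\<forall>f\<in>semigroup_algebra S. \<forall>g\<in>semigroup_algebra S. D (f * g) = D f * g + f * D g)}"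

definition derivations_ideal ::
    "'m::ab_group_add set \<Rightarrow> ('m \<Rightarrow>\<^sub>0 'k::field_char_0) set \<Rightarrow> ('m, 'k) operator set" where
  "derivations_ideal S I = {D \<in> derivations S. D ` I \<subseteq> I}"

text \<open>
  The map \<open>\<partial>\<^bsub>\<alpha>,p\<^esub>\<close>, i.e. \<open>x\<^sup>m \<mapsto> p(m) x\<^bsup>m+\<alpha>\<^esup>\<close> extended linearly to \<open>\<k>[S]\<close>.
\<close>

definition hom_der ::
    "'m::ab_group_add set \<Rightarrow> 'm \<Rightarrow> ('m \<Rightarrow> 'k::field_char_0) \<Rightarrow> ('m, 'k) operator" where
  "hom_der S \<alpha> p f =
     (if f \<in> semigroup_algebra S
      then \<Sum>m\<in>Poly_Mapping.keys f. Poly_Mapping.single (m + \<alpha>) (Poly_Mapping.lookup f m * p m)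
      else 0)"

section \<open>Direct sums of spaces of operators\<close>

definition op_scale ::
    "'k::field_char_0 \<Rightarrow> ('m::ab_group_add, 'k) operator \<Rightarrow> ('m, 'k) operator" where
  "op_scale c D = (\<lambda>f. scal c (D f))"

definition op_subspace :: "('m::ab_group_add, 'k::field_char_0) operator set \<Rightarrow> bool" where
  "op_subspace V \<longleftrightarrow> submonoid V \<and> (\<forall>c. \<forall>D\<in>V. op_scale c D \<in> V)"

definition sum_of_spaces :: "'i set \<Rightarrow> ('i \<Rightarrow> 'v::comm_monoid_add set) \<Rightarrow> 'v set" where
  "sum_of_spaces A V = {\<Sum>i\<in>F. v i | F v. finite F \<and> F \<subseteq> A \<and> (\<forall>i\<in>F. v i \<in> V i)}"

text \<open>\<open>W\<close> is the internal direct sum of the subspaces \<open>V i\<close>, for \<open>i \<in> A\<close>.\<close>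

definition is_direct_sum ::
    "('m::ab_group_add, 'k::field_char_0) operator set \<Rightarrow> 'i set \<Rightarrow>
     ('i \<Rightarrow> ('m, 'k) operator set) \<Rightarrow> bool" where
  "is_direct_sum W A V \<longleftrightarrow>
     (\<forall>i\<in>A. op_subspace (V i)) \<and>
     W = sum_of_spaces A V \<and>
     (\<forall>F v. finite F \<and> F \<subseteq> A \<and> (\<forall>i\<in>F. v i \<in> V i) \<and> (\<Sum>i\<in>F. v i) = 0
        \<longrightarrow> (\<forall>i\<in>F. v i = 0))"

definition is_direct_sum2 ::
    "('m::ab_group_add, 'k::field_char_0) operator set \<Rightarrow>
     ('m, 'k) operator set \<Rightarrow> ('m, 'k) operator set \<Rightarrow> bool" where
  "is_direct_sum2 W U V \<longleftrightarrow>
     op_subspace U \<and> op_subspace V \<and> W = {D + E | D E. D \<in> U \<and> E \<in> V} \<and> U \<inter> V = {0}"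

section \<open>The spaces of derivations\<close>

definition g_comp :: "'m::ab_group_add set \<Rightarrow> 'm \<Rightarrow> ('m, 'k::field_char_0) operator set" where
  "g_comp S \<alpha> = {hom_der S \<alpha> p | p. p \<in> dual_lattice_over}"

definition s_comp :: "'m::ab_group_add set \<Rightarrow> 'm \<Rightarrow> ('m, 'k::field_char_0) operator set" where
  "s_comp S \<alpha> = {hom_der S \<alpha> (\<lambda>m. c * of_int (root_ray S \<alpha> m)) | c. True}"

text \<open>The sums defining these two spaces are direct; see \<open>g_space_direct\<close>, \<open>s_space_direct\<close> below.\<close>

definition g_space :: "'m::ab_group_add set \<Rightarrow> ('m, 'k::field_char_0) operator set" where
  "g_space S = sum_of_spaces S (g_comp S)"

definition s_space :: "'m::ab_group_add set \<Rightarrow> ('m, 'k::field_char_0) operator set" where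
  "s_space S = sum_of_spaces (roots S) (s_comp S)"

definition s_space_ideal ::
    "'m::ab_group_add set \<Rightarrow> ('m \<Rightarrow>\<^sub>0 'k::field_char_0) set \<Rightarrow> ('m, 'k) operator set" where
  "s_space_ideal S I = {D \<in> s_space S. D ` I \<subseteq> I}"

text \<open>
  The set depends on \<open>I\<close> and on the chosen monomial generators \<open>a 1, \<dots>, a l\<close> of \<open>I\<close>.
\<close>

definition roots_of_ideal ::
    "'m::ab_group_add set \<Rightarrow> nat \<Rightarrow> (nat \<Rightarrow> 'm) \<Rightarrow> ('m \<Rightarrow>\<^sub>0 'k::field_char_0) set \<Rightarrow>
     ('m \<Rightarrow> int) \<Rightarrow> 'm set" where
  "roots_of_ideal S l a I \<rho> =
     {\<alpha> \<in> roots_of S \<rho>. \<forall>i\<in>{1..l}. a i \<notin> perp \<rho> \<longrightarrow> a i + \<alpha> \<in> supp S I}"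

definition roots_ideal ::
    "'m::ab_group_add set \<Rightarrow> nat \<Rightarrow> (nat \<Rightarrow> 'm) \<Rightarrow> ('m \<Rightarrow>\<^sub>0 'k::field_char_0) set \<Rightarrow> 'm set" where
  "roots_ideal S l a I = (\<Union>\<rho>\<in>dual_rays S. roots_of_ideal S l a I \<rho>)"

section \<open>Directness of the defining sums\<close>

lemma sum_fun_apply: "(\<Sum>i\<in>F. v i) x = (\<Sum>i\<in>F. v i x)"
  for v :: "'i \<Rightarrow> 'a \<Rightarrow> 'b::comm_monoid_add"
  by (induction F rule: infinite_finite_induct) auto

lemma hom_der_monom:
  "m \<in> S \<Longrightarrow> hom_der S \<alpha> p (monom_x m) = Poly_Mapping.single (m + \<alpha>) (p m)"
  by (simp add: hom_der_def semigroup_algebra_def)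

lemma hom_der_cong_zero:
  assumes "\<And>m. m \<in> S \<Longrightarrow> p m = 0"
  shows "hom_der S \<alpha> p = 0"
proof
  fix f
  show "hom_der S \<alpha> p f = 0 f"
    using assms by (auto simp: hom_der_def semigroup_algebra_def intro!: sum.neutral)
qed

lemma hom_der_independent:
  assumes "finite F" "(\<Sum>\<alpha>\<in>F. hom_der S \<alpha> (p \<alpha>)) = 0" "\<alpha> \<in> F"
  shows "hom_der S \<alpha> (p \<alpha>) = 0"
proof (rule hom_der_cong_zero)
  fix m assume m: "m \<in> S"
  have "(\<Sum>\<beta>\<in>F. hom_der S \<beta> (p \<beta>)) (monom_x m) = 0"
    using assms(2) by simp
  hence "(\<Sum>\<beta>\<in>F. Poly_Mapping.single (m + \<beta>) (p \<beta> m)) = 0"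
    using m by (simp add: sum_fun_apply hom_der_monom)
  hence "Poly_Mapping.lookup (\<Sum>\<beta>\<in>F. Poly_Mapping.single (m + \<beta>) (p \<beta> m)) (m + \<alpha>) = 0"
    by simp
  hence "(\<Sum>\<beta>\<in>F. if \<beta> = \<alpha> then p \<beta> m else 0) = 0"
    by (simp add: lookup_sum lookup_single when_def)
  thus "p \<alpha> m = 0"
    using assms by (simp add: sum.delta)
qed

lemma hom_der_add: "hom_der S \<alpha> p + hom_der S \<alpha> q = hom_der S \<alpha> (\<lambda>m. p m + q m)"
  by (rule ext) (simp add: hom_der_def distrib_left single_add sum.distrib)

lemma hom_der_scale: "op_scale c (hom_der S \<alpha> p) = hom_der S \<alpha> (\<lambda>m. c * p m)"
  by (rule ext)
    (simp add: op_scale_def scal_def hom_der_def sum_distrib_left mult_single mult.left_commute)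

lemma hom_der_zero: "hom_der S \<alpha> (\<lambda>m. 0) = 0"
  by (rule hom_der_cong_zero) simp

lemma dual_lattice_over_zero: "(\<lambda>m. 0) \<in> dual_lattice_over"
  unfolding dual_lattice_over_def by (intro CollectI exI[of _ "{}"]) auto

lemma dual_lattice_over_scale:
  assumes "p \<in> dual_lattice_over" shows "(\<lambda>m. c * p m) \<in> dual_lattice_over"
proof -
  obtain F d where "p = (\<lambda>m. \<Sum>q\<in>F. d q * of_int (q m))" "finite F" "F \<subseteq> dual_lattice"
    using assms unfolding dual_lattice_over_def by blast
  thus ?thesis unfolding dual_lattice_over_def
    by (intro CollectI exI[of _ F] exI[of _ "\<lambda>q. c * d q"]) (simp add: sum_distrib_left mult.assoc)
qed

lemma dual_lattice_over_add:
  assumes "p \<in> dual_lattice_over" "p' \<in> dual_lattice_over"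
  shows "(\<lambda>m. p m + p' m) \<in> dual_lattice_over"
proof -
  obtain F d where p: "p = (\<lambda>m. \<Sum>q\<in>F. d q * of_int (q m))" and F: "finite F" "F \<subseteq> dual_lattice"
    using assms unfolding dual_lattice_over_def by blast
  obtain F' d' where p': "p' = (\<lambda>m. \<Sum>q\<in>F'. d' q * of_int (q m))"
    and F': "finite F'" "F' \<subseteq> dual_lattice"
    using assms unfolding dual_lattice_over_def by blast
  define e where "e q = (if q \<in> F then d q else 0) + (if q \<in> F' then d' q else 0)" for q
  have "p m + p' m = (\<Sum>q\<in>F \<union> F'. e q * of_int (q m))" for m
  proof -
    have "p m = (\<Sum>q\<in>F \<union> F'. (if q \<in> F then d q else 0) * of_int (q m))"
      unfolding p using F F' by (intro sum.mono_neutral_cong_left) auto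
    moreover have "p' m = (\<Sum>q\<in>F \<union> F'. (if q \<in> F' then d' q else 0) * of_int (q m))"
      unfolding p' using F F' by (intro sum.mono_neutral_cong_left) auto
    ultimately show ?thesis by (simp add: e_def distrib_right sum.distrib)
  qed
  thus ?thesis unfolding dual_lattice_over_def using F F'
    by (intro CollectI exI[of _ "F \<union> F'"] exI[of _ e]) auto
qed

lemma op_subspace_hom_der:
  assumes "(\<lambda>m. 0) \<in> P" "\<And>p q. p \<in> P \<Longrightarrow> q \<in> P \<Longrightarrow> (\<lambda>m. p m + q m) \<in> P"
    and "\<And>c p. p \<in> P \<Longrightarrow> (\<lambda>m. c * p m) \<in> P"
  shows "op_subspace (hom_der S \<alpha> ` P)"
  unfolding op_subspace_def submonoid_def
proof (intro conjI ballI allI)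
  show "0 \<in> hom_der S \<alpha> ` P"
    using imageI[OF assms(1), of "hom_der S \<alpha>"] by (simp add: hom_der_zero)
next
  fix D E assume "D \<in> hom_der S \<alpha> ` P" "E \<in> hom_der S \<alpha> ` P"
  then obtain p q where "D = hom_der S \<alpha> p" "E = hom_der S \<alpha> q" "p \<in> P" "q \<in> P"
    by blast
  thus "D + E \<in> hom_der S \<alpha> ` P"
    unfolding \<open>D = _\<close> \<open>E = _\<close> hom_der_add by (intro imageI assms(2))
next
  fix c D assume "D \<in> hom_der S \<alpha> ` P"
  then obtain p where "D = hom_der S \<alpha> p" "p \<in> P" by blast
  thus "op_scale c D \<in> hom_der S \<alpha> ` P"
    unfolding \<open>D = _\<close> hom_der_scale by (intro imageI assms(3))
qed

lemma op_subspace_g_comp: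
  "op_subspace (g_comp S \<alpha> :: ('m::ab_group_add, 'k::field_char_0) operator set)"
proof -
  have eq: "(g_comp S \<alpha> :: ('m, 'k) operator set) = hom_der S \<alpha> ` dual_lattice_over"
    by (auto simp: g_comp_def)
  show ?thesis unfolding eq
    by (rule op_subspace_hom_der)
      (fact dual_lattice_over_zero dual_lattice_over_add dual_lattice_over_scale)+
qed

lemma op_subspace_s_comp:
  "op_subspace (s_comp S \<alpha> :: ('m::ab_group_add, 'k::field_char_0) operator set)"
proof -
  let ?P = "range (\<lambda>(c::'k) m. c * of_int (root_ray S \<alpha> m))"
  have "(s_comp S \<alpha> :: ('m, 'k) operator set) = hom_der S \<alpha> ` ?P" by (auto simp: s_comp_def)
  moreover have "op_subspace (hom_der S \<alpha> ` ?P)"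
  proof (rule op_subspace_hom_der, goal_cases)
    case 1
    show ?case by (rule range_eqI[of _ _ 0]) simp
  next
    case (2 p q)
    then obtain c d where "p = (\<lambda>m. c * of_int (root_ray S \<alpha> m))"
      "q = (\<lambda>m. d * of_int (root_ray S \<alpha> m))" by blast
    thus ?case by (intro range_eqI[of _ _ "c + d"]) (simp add: distrib_right)
  next
    case (3 c p)
    then obtain d where "p = (\<lambda>m. d * of_int (root_ray S \<alpha> m))" by blast
    thus ?case by (intro range_eqI[of _ _ "c * d"]) (simp add: mult.assoc)
  qed
  ultimately show ?thesis by simp
qed

lemma direct_if_homogeneous:
  assumes "\<And>\<alpha>. op_subspace (V \<alpha>)" "\<And>\<alpha>. V \<alpha> \<subseteq> range (hom_der S \<alpha>)"
  shows "is_direct_sum (sum_of_spaces A V) A V"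
  unfolding is_direct_sum_def
proof (intro conjI allI impI ballI, goal_cases)
  case (3 F v \<alpha>)
  hence "\<forall>\<beta>\<in>F. \<exists>p. v \<beta> = hom_der S \<beta> p" using assms(2) by blast
  then obtain p where p: "\<And>\<beta>. \<beta> \<in> F \<Longrightarrow> v \<beta> = hom_der S \<beta> (p \<beta>)" by metis
  hence "(\<Sum>\<beta>\<in>F. hom_der S \<beta> (p \<beta>)) = 0" using 3 by simp
  with 3 have "hom_der S \<alpha> (p \<alpha>) = 0" by (intro hom_der_independent) auto
  thus ?case using p 3 by simp
qed (use assms in auto)

lemma g_space_direct: "is_direct_sum (g_space S) S (g_comp S)"
  unfolding g_space_def
  by (rule direct_if_homogeneous[OF op_subspace_g_comp]) (auto simp: g_comp_def)

lemma s_space_direct: "is_direct_sum (s_space S) (roots S) (s_comp S)"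
  unfolding s_space_def
  by (rule direct_if_homogeneous[OF op_subspace_s_comp]) (auto simp: s_comp_def)

end

theory Submission
  imports Defs
begin

text \<open>
  Everything is graded by \<open>M\<close>. A derivation \<open>D\<close> of \<open>\<k>[S]\<close> is the sum of its homogeneous
  parts, and the Leibniz rule says that the part of degree \<open>\<alpha>\<close> sends \<open>x\<^sup>m\<close> to \<open>p(m) x\<^bsup>m+\<alpha>\<^esup>\<close> with
  \<open>p\<close> additive on \<open>S\<close>, hence on \<open>M\<close>; finitely many degrees occur because \<open>S\<close> is finitely
  generated (\<open>derivation_decomposition\<close>). If \<open>\<alpha>\<close> lies in \<open>S\<close>, such a part belongs to \<open>g\<close>. If not,
  some ray \<open>\<rho>\<close> of the dual semigroup is negative at \<open>\<alpha>\<close>. For \<open>m \<in> S\<close> with \<open>\<rho>(m) = 0\<close> the point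
  \<open>m + \<alpha>\<close> is then outside \<open>S\<close>, which forces \<open>p(m) = 0\<close>; as the facet \<open>S \<inter> \<rho>\<^sup>\<bottom>\<close> spans \<open>\<rho>\<^sup>\<bottom>\<close>, the
  function \<open>p\<close> is a multiple of \<open>\<rho>\<close>. The same holds for every other ray that is negative at \<open>\<alpha>\<close>,
  so there is none, and an element of \<open>S\<close> of height one over the facet shows \<open>\<rho>(\<alpha>) = -1\<close>. Thus
  \<open>\<alpha>\<close> is a root and the part lies in \<open>s\<close> (\<open>outer_degree_is_root\<close>).

  A monomial ideal is the span of its monomials, so that a sum of homogeneous operators
  preserves it iff each summand does (\<open>sum_hom_der_preserves_iff\<close>). Operators in \<open>g\<close> always do,
  and for a root the condition can be tested on the generators of the ideal
  (\<open>s_space_ideal_eq\<close>). Since no root lies in \<open>S\<close>, the spaces \<open>g\<close> and \<open>s\<close> intersect trivially.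

  The convex geometry behind this is the duality between \<open>S\<close> and its dual semigroup: a lattice
  point on which all rays are nonnegative lies in \<open>S\<close> (\<open>in_S_if_rays_nonneg\<close>), the integral and
  \<open>\<k>\<close>-valued functions that vanish on a facet are multiples of its ray
  (\<open>ray_annihilator_int\<close>, \<open>ray_annihilator\<close>), and every ray takes the value one on \<open>S\<close>
  (\<open>ray_height_one\<close>). All of it is derived, without passing to real cones, from a Farkas lemma for
  finitely many elements of an abelian group (\<open>Farkas_int\<close>); saturation enters in the form that
  \<open>S\<close> contains \<open>x\<close> as soon as it contains a positive multiple of \<open>x\<close>.
\<close>

section \<open>Integer multiples\<close>

text \<open>
  The abelian group is only a type of class \<open>ab_group_add\<close>; this is its structure of a module over
  the integers, so that the general laws of scalar multiplication apply.
\<close>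

definition int_mult :: "int \<Rightarrow> 'm::ab_group_add \<Rightarrow> 'm" where
  "int_mult k x = (\<Sum>i<nat k. x) - (\<Sum>i<nat (- k). x)"

lemma sum_const_add: "(\<Sum>i<a + b. x) = (\<Sum>i<a. x) + (\<Sum>i<b. x)"
  for x :: "'m::comm_monoid_add" and a b :: nat
  by (induction b) (simp_all add: add_ac)

lemma int_mult_diff: "int_mult (int a - int b) x = (\<Sum>i<a. x) - (\<Sum>i<b. x)"
proof (cases "a \<le> b")
  case True
  then obtain c where "b = a + c" using le_Suc_ex by blast
  thus ?thesis by (simp add: int_mult_def sum_const_add)
next
  case False
  then obtain c where "a = b + c" using le_Suc_ex nat_le_linear by blast
  thus ?thesis by (simp add: int_mult_def sum_const_add)
qed

interpretation int_mult: module "int_mult :: int \<Rightarrow> 'm::ab_group_add \<Rightarrow> 'm"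
proof
  have add_left: "int_mult (k + l) x = int_mult k x + int_mult l x" for k l and x :: 'm
  proof -
    obtain a b where k: "k = int a - int b" by (rule int_diff_cases)
    obtain c d where l: "l = int c - int d" by (rule int_diff_cases)
    have "k + l = int (a + c) - int (b + d)" using k l by simp
    thus ?thesis by (simp only: k l int_mult_diff sum_const_add) simp
  qed
  have one: "int_mult 1 x = x" and zero: "int_mult 0 x = 0"
    and neg: "int_mult (- k) x = - int_mult k x" for k and x :: 'm
    by (simp_all add: int_mult_def)
  have nonneg: "int_mult (int a * l) x = int_mult (int a) (int_mult l x)" for a l and x :: 'm
    by (induction a) (simp_all add: zero one add_left distrib_right)
  fix k l :: int and x y :: 'm
  show "int_mult k (x + y) = int_mult k x + int_mult k y"
    by (simp add: int_mult_def sum.distrib)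
  show "int_mult (k + l) x = int_mult k x + int_mult l x" by (fact add_left)
  show "int_mult 1 x = x" by (fact one)
  show "int_mult k (int_mult l x) = int_mult (k * l) x"
    by (cases k rule: int_cases2) (simp_all add: nonneg neg)
qed

lemma additive_int_mult:
  fixes p :: "'m::ab_group_add \<Rightarrow> 'k::comm_ring_1"
  assumes "additive p"
  shows "p (int_mult k x) = of_int k * p x"
proof -
  obtain a b where "k = int a - int b" by (rule int_diff_cases)
  thus ?thesis
    by (simp add: int_mult_diff additive.diff[OF assms] additive.sum[OF assms] left_diff_distrib)
qed

lemma additive_lincomb:
  fixes q r :: "'m::ab_group_add \<Rightarrow> int"
  assumes "additive q" "additive r"
  shows "additive (\<lambda>x. c * q x + d * r x)"
  by unfold_locales (simp add: additive.add[OF assms(1)] additive.add[OF assms(2)] algebra_simps)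

section \<open>Submonoids\<close>

lemma submonoid_hull: "submonoid (submonoid hull T)"
  by (rule hull_in) (auto simp: submonoid_def)

lemma submonoid_zero: "submonoid T \<Longrightarrow> 0 \<in> T"
  and submonoid_add: "submonoid T \<Longrightarrow> x \<in> T \<Longrightarrow> y \<in> T \<Longrightarrow> x + y \<in> T"
  by (auto simp: submonoid_def)

lemma submonoid_sum: "submonoid T \<Longrightarrow> (\<And>i. i \<in> A \<Longrightarrow> f i \<in> T) \<Longrightarrow> sum f A \<in> T"
  by (induction A rule: infinite_finite_induct) (auto simp: submonoid_def)

lemma submonoid_int_mult: "submonoid T \<Longrightarrow> x \<in> T \<Longrightarrow> 0 \<le> k \<Longrightarrow> int_mult k x \<in> T"
  by (simp add: int_mult_def submonoid_sum)

lemma submonoid_hull_nonneg: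
  fixes q :: "'m::ab_group_add \<Rightarrow> int"
  assumes "additive q" "\<And>g. g \<in> G \<Longrightarrow> 0 \<le> q g" "m \<in> submonoid hull G"
  shows "0 \<le> q m"
  using assms(3)
  by (rule hull_induct)
    (auto simp: assms(2) submonoid_def additive.zero[OF assms(1)] additive.add[OF assms(1)])

lemma submonoid_hull_zero:
  fixes p :: "'m::ab_group_add \<Rightarrow> 'k::ab_group_add"
  assumes "additive p" "\<And>g. g \<in> G \<Longrightarrow> p g = 0" "m \<in> submonoid hull G"
  shows "p m = 0"
  using assms(3)
  by (rule hull_induct)
    (auto simp: assms(2) submonoid_def additive.zero[OF assms(1)] additive.add[OF assms(1)])

lemma submonoid_hull_singleton:
  "submonoid hull {x} = range (\<lambda>k. int_mult (int k) x)" for x :: "'m::ab_group_add"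
proof (rule hull_unique)
  have "x = int_mult (int 1) x" by simp
  thus "{x} \<subseteq> range (\<lambda>k. int_mult (int k) x)" by blast
  show "submonoid (range (\<lambda>k. int_mult (int k) x))"
    unfolding submonoid_def
  proof (intro conjI ballI)
    show "0 \<in> range (\<lambda>k. int_mult (int k) x)" by (rule range_eqI[of _ _ 0]) simp
  next
    fix y z assume "y \<in> range (\<lambda>k. int_mult (int k) x)" "z \<in> range (\<lambda>k. int_mult (int k) x)"
    then obtain k l where "y = int_mult (int k) x" "z = int_mult (int l) x" by blast
    thus "y + z \<in> range (\<lambda>k. int_mult (int k) x)"
      by (intro range_eqI[of _ _ "k + l"]) (simp add: int_mult.scale_left_distrib)
  qed
qed (auto intro!: submonoid_int_mult)

lemma int_mult_fun_apply: "int_mult k \<rho> m = k * \<rho> m" for \<rho> :: "'m \<Rightarrow> int"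
proof -
  obtain a b where "k = int a - int b" by (rule int_diff_cases)
  thus ?thesis by (simp add: int_mult_diff sum_fun_apply left_diff_distrib)
qed

lemma submonoid_hull_functional:
  "submonoid hull {\<rho>} = range (\<lambda>k m. int k * \<rho> m)" for \<rho> :: "'m \<Rightarrow> int"
  unfolding submonoid_hull_singleton by (intro image_cong refl ext) (simp add: int_mult_fun_apply)

section \<open>The Farkas lemma over the integers\<close>

text \<open>
  Induction on the number of generators. Remove a generator \<open>g\<close>; if a functional \<open>q\<close> separates \<open>b\<close>
  from the others but is negative at \<open>g\<close>, project along \<open>g\<close> onto the hyperplane \<open>q = 0\<close> and apply
  the induction hypothesis to the projections of \<open>b\<close> and of the other generators. A conic
  combination of the projections lifts back because the coefficients of \<open>g\<close> that appear are
  nonnegative, and a functional that separates the projections pulls back to one that vanishes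
  at \<open>g\<close>. Denominators are cleared throughout, which is why the first alternative speaks of a
  positive multiple of \<open>b\<close>. Without generators, one needs a functional that is nonzero at a given
  \<open>b \<noteq> 0\<close>.
\<close>

lemma Farkas_int:
  fixes G :: "'m::ab_group_add set"
  assumes separated: "\<And>x::'m. x \<noteq> 0 \<Longrightarrow> \<exists>q::'m \<Rightarrow> int. additive q \<and> q x \<noteq> 0"
    and "finite G"
  shows "(\<exists>N>0. int_mult N b \<in> submonoid hull G) \<or>
         (\<exists>q::'m \<Rightarrow> int. additive q \<and> (\<forall>g\<in>G. 0 \<le> q g) \<and> q b < 0)"
  using \<open>finite G\<close>
proof (induction "card G" arbitrary: G b rule: less_induct)
  case less
  note C = submonoid_hull[of G]
  show ?case
  proof (cases "G = {}")
    case G: True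
    show ?thesis
    proof (cases "b = 0")
      case True
      have "int_mult 1 b \<in> submonoid hull G"
        using True submonoid_zero[OF C] by auto
      thus ?thesis using zero_less_one by blast
    next
      case False
      then obtain q :: "'m \<Rightarrow> int" where q: "additive q" "q b \<noteq> 0" using separated by blast
      have "additive (\<lambda>x. - sgn (q b) * q x + 0 * q x)" by (rule additive_lincomb) fact+
      moreover have "- sgn (q b) * q b < 0" using q by (auto simp: sgn_if)
      ultimately show ?thesis using G by (intro disjI2 exI[of _ "\<lambda>x. - sgn (q b) * q x"]) auto
    qed
  next
    case False
    then obtain g G' where G: "G = insert g G'" "g \<notin> G'" by (meson equals0I mk_disjoint_insert)
    with less.prems have fin: "finite G'" and card: "card G' < card G" by auto
    have sub: "submonoid hull G' \<subseteq> submonoid hull G" using G by (intro hull_mono) auto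
    from less.hyps[OF card fin, of b] consider
      N where "N > 0" "int_mult N b \<in> submonoid hull G'"
      | q :: "'m \<Rightarrow> int" where "additive q" "\<forall>x\<in>G'. 0 \<le> q x" "q b < 0" by auto
    thus ?thesis
    proof cases
      case 1
      thus ?thesis using sub by blast
    next
      case (2 q)
      show ?thesis
      proof (cases "q g \<ge> 0")
        case True
        thus ?thesis using 2 G by auto
      next
        case False
        \<comment> \<open>The projection along \<open>g\<close>, cleared of the denominator \<open>- q g > 0\<close>.\<close>
        define \<pi> where "\<pi> x = int_mult (- q g) x + int_mult (q x) g" for x
        have gC: "g \<in> submonoid hull G" and GC: "\<And>x. x \<in> G' \<Longrightarrow> x \<in> submonoid hull G"
          using G by (auto intro: hull_inc)
        have \<pi>C: "submonoid hull (\<pi> ` G') \<subseteq> submonoid hull G"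
        proof (intro hull_minimal C subsetI, elim imageE)
          fix x y assume "y \<in> G'" "x = \<pi> y"
          thus "x \<in> submonoid hull G"
            using 2 False gC GC
            by (simp only: \<pi>_def) (intro submonoid_add[OF C] submonoid_int_mult[OF C], auto)
        qed
        have "card (\<pi> ` G') < card G" using card card_image_le[OF fin, of \<pi>] by linarith
        from less.hyps[OF this finite_imageI[OF fin], of "\<pi> b"] consider
          N where "N > 0" "int_mult N (\<pi> b) \<in> submonoid hull (\<pi> ` G')"
          | r :: "'m \<Rightarrow> int" where "additive r" "\<forall>x\<in>\<pi> ` G'. 0 \<le> r x" "r (\<pi> b) < 0" by auto
        thus ?thesis
        proof cases
          case (1 N)
          have "int_mult (N * (- q g)) b = int_mult N (\<pi> b) + int_mult (N * (- q b)) g"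
            by (simp add: \<pi>_def int_mult.scale_right_diff_distrib)
          moreover have "int_mult N (\<pi> b) + int_mult (N * (- q b)) g \<in> submonoid hull G"
          proof (rule submonoid_add[OF C])
            show "int_mult N (\<pi> b) \<in> submonoid hull G" using 1 \<pi>C by blast
            show "int_mult (N * (- q b)) g \<in> submonoid hull G"
              using 1 2 gC by (intro submonoid_int_mult[OF C] mult_nonneg_nonneg) auto
          qed
          moreover have "N * (- q g) > 0" using 1 False by (intro mult_pos_pos) auto
          ultimately show ?thesis by metis
        next
          case (2 r)
          have "additive (\<lambda>x. r (\<pi> x))"
            by unfold_locales (simp add: \<pi>_def additive.add[OF \<open>additive q\<close>] algebra_simps
                additive.add[OF \<open>additive r\<close>] additive.diff[OF \<open>additive r\<close>])
          moreover have "r (\<pi> g) = 0" using 2 by (simp add: \<pi>_def additive.zero)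
          ultimately show ?thesis using 2 G by (intro disjI2 exI[of _ "\<lambda>x. r (\<pi> x)"]) auto
        qed
      qed
    qed
  qed
qed

section \<open>Rays of the dual semigroup\<close>

text \<open>
  The zeros of \<open>q\<close> among the generators span the hyperplane \<open>q = 0\<close> rationally; this is expressed
  dually, by saying that \<open>q\<close> spans the annihilator of these zeros.
\<close>

definition facet_functional :: "'m::ab_group_add set \<Rightarrow> ('m \<Rightarrow> int) \<Rightarrow> bool" where
  "facet_functional G q \<longleftrightarrow>
     (\<forall>r::'m \<Rightarrow> int. additive r \<longrightarrow> (\<forall>g\<in>G. q g = 0 \<longrightarrow> r g = 0) \<longrightarrow>
        (\<exists>A B. A \<noteq> 0 \<and> (\<forall>x. A * r x = B * q x)))"

text \<open>
  A finitely generated submonoid \<open>S\<close> that generates its group as differences and is saturated in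
  the integral sense, in a group whose integral functionals separate points. These are the
  properties of the lattice and of the cone in the form in which the Farkas lemma uses them.
\<close>

locale saturated_semigroup =
  fixes S G :: "'m::ab_group_add set"
  assumes finite_G: "finite G"
    and S_eq: "S = submonoid hull G"
    and differences: "\<And>x. \<exists>s\<in>S. \<exists>t\<in>S. x = s - t"
    and separated: "\<And>x::'m. x \<noteq> 0 \<Longrightarrow> \<exists>q::'m \<Rightarrow> int. additive q \<and> q x \<noteq> 0"
    and divisible: "\<And>N x. N > 0 \<Longrightarrow> int_mult N x \<in> S \<Longrightarrow> x \<in> S"
begin

lemma submonoid_S: "submonoid S"
  by (simp add: S_eq submonoid_hull)

lemma G_subset: "G \<subseteq> S"
  by (simp add: S_eq hull_subset)

lemma zero_on_S_imp_zero:
  fixes p :: "'m \<Rightarrow> 'k::ab_group_add"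
  assumes "additive p" "\<And>m. m \<in> S \<Longrightarrow> p m = 0"
  shows "p x = 0"
  using differences[of x] assms by (auto simp: additive.diff[OF assms(1)])

lemma zero_on_G_imp_zero:
  fixes p :: "'m \<Rightarrow> 'k::ab_group_add"
  assumes "additive p" "\<And>g. g \<in> G \<Longrightarrow> p g = 0"
  shows "p x = 0"
  by (rule zero_on_S_imp_zero[OF assms(1)], rule submonoid_hull_zero[OF assms]) (simp_all add: S_eq)

lemma dual_semigroup_iff:
  "q \<in> dual_semigroup S \<longleftrightarrow> additive q \<and> (\<forall>g\<in>G. 0 \<le> q g)"
  using submonoid_hull_nonneg[of q G] G_subset
  by (auto simp: dual_semigroup_def dual_lattice_def S_eq)

lemma Farkas:
  assumes "finite T"
  shows "(\<exists>N>0. int_mult N b \<in> submonoid hull T) \<or>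
         (\<exists>q::'m \<Rightarrow> int. additive q \<and> (\<forall>g\<in>T. 0 \<le> q g) \<and> q b < 0)"
  by (rule Farkas_int) (fact separated assms)+

text \<open>
  The Farkas lemma and saturation provide functionals in the dual semigroup that are negative at
  \<open>\<alpha>\<close>. Let \<open>q\<close> be one with the largest number of zeros among the generators. If it did not define
  a facet, some functional \<open>r\<close> that is no rational multiple of \<open>q\<close> would vanish at these zeros. 
  After subtracting a multiple of \<open>q\<close>, also \<open>r \<alpha> = 0\<close>. Now \<open>q\<close> can be moved in the direction of \<open>r\<close>
  or \<open>-r\<close> until a further generator becomes a zero; its value at \<open>\<alpha>\<close> stays negative.
\<close>

lemma separating_facet:
  assumes "\<alpha> \<notin> S"
  shows "\<exists>q\<in>dual_semigroup S. q \<alpha> < 0 \<and> facet_functional G q"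
proof -
  define Q where "Q = {q \<in> dual_semigroup S. q \<alpha> < 0}"
  define Z where "Z q = {g \<in> G. q g = (0::int)}" for q
  have "\<exists>q. q \<in> Q"
    using Farkas[OF finite_G, of \<alpha>, folded S_eq] divisible[of _ \<alpha>] assms
    by (auto simp: Q_def dual_semigroup_iff)
  moreover have "card (Z q) < Suc (card G)" for q
    using finite_G by (auto simp: Z_def less_Suc_eq_le intro: card_mono)
  ultimately obtain q where q: "q \<in> Q" and max: "\<And>q'. q' \<in> Q \<Longrightarrow> card (Z q') \<le> card (Z q)"
    using ex_has_greatest_nat[of "\<lambda>q. q \<in> Q" _ "\<lambda>q. card (Z q)" "Suc (card G)"] by blast
  have qa: "additive q" and q_nonneg: "\<And>g. g \<in> G \<Longrightarrow> 0 \<le> q g" and q\<alpha>: "q \<alpha> < 0"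
    using q by (auto simp: Q_def dual_semigroup_iff)
  have no_neg: False
    if r: "additive r" "r \<alpha> = 0" "\<And>g. g \<in> Z q \<Longrightarrow> r g = 0" and neg: "\<exists>g\<in>G. r g < 0"
    for r :: "'m \<Rightarrow> int"
  proof -
    let ?ratio = "\<lambda>g. rat_of_int (q g) / rat_of_int (- r g)"
    have "finite {g\<in>G. r g < 0}" "{g\<in>G. r g < 0} \<noteq> {}" using finite_G neg by auto
    then obtain h where h: "h \<in> G" "r h < 0"
      and min: "\<And>g. g \<in> G \<Longrightarrow> r g < 0 \<Longrightarrow> ?ratio h \<le> ?ratio g"
      using ex_is_arg_min_if_finite[of "{g\<in>G. r g < 0}" ?ratio]
      by (auto simp: is_arg_min_linorder)
    \<comment> \<open>The first zero is met at a generator \<open>h\<close> of minimal ratio; \<open>q'\<close> is \<open>q + (q h / - r h) r\<close>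
      cleared of its denominator.\<close>
    define q' where "q' x = - r h * q x + q h * r x" for x
    have a: "additive q'" unfolding q'_def by (rule additive_lincomb) fact+
    have "0 \<le> q' g" if "g \<in> G" for g
    proof (cases "r g < 0")
      case True
      have "rat_of_int (q h) * rat_of_int (- r g) \<le> rat_of_int (q g) * rat_of_int (- r h)"
        using min[OF that True] h True by (simp add: field_simps)
      hence "rat_of_int (q h * (- r g)) \<le> rat_of_int (q g * (- r h))" by simp
      hence "q h * (- r g) \<le> q g * (- r h)" by (simp only: of_int_le_iff)
      thus ?thesis by (simp add: q'_def algebra_simps)
    next
      case False
      thus ?thesis using h that q_nonneg unfolding q'_def
        by (intro add_nonneg_nonneg mult_nonneg_nonneg) auto
    qed
    moreover have "q' \<alpha> < 0" using h q\<alpha> r(2) by (simp add: q'_def mult_neg_neg)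
    ultimately have "q' \<in> Q" using a by (auto simp: Q_def dual_semigroup_iff)
    moreover have "Z q \<subset> Z q'"
    proof
      show "Z q \<subseteq> Z q'" using r(3) by (auto simp: Z_def q'_def)
      have "h \<in> Z q'" "h \<notin> Z q" using h r(3) by (auto simp: Z_def q'_def)
      thus "Z q \<noteq> Z q'" by blast
    qed
    hence "card (Z q) < card (Z q')" using finite_G by (intro psubset_card_mono) (auto simp: Z_def)
    ultimately show False using max by fastforce
  qed
  have "facet_functional G q"
    unfolding facet_functional_def
  proof (intro allI impI)
    fix r :: "'m \<Rightarrow> int"
    assume r: "additive r" "\<forall>g\<in>G. q g = 0 \<longrightarrow> r g = 0"
    \<comment> \<open>\<open>r0 1\<close> is the combination of \<open>r\<close> and \<open>q\<close> that vanishes at \<open>\<alpha>\<close>, and \<open>c = -1\<close> gives its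
      negative: neither of them can be negative on a generator.\<close>
    define r0 where "r0 c x = c * q \<alpha> * r x + (- c * r \<alpha>) * q x" for c x
    have a: "additive (r0 c)" for c unfolding r0_def by (rule additive_lincomb) fact+
    have "0 \<le> r0 c g" if "g \<in> G" for c g
      using no_neg[OF a[of c]] r(2) that by (force simp: r0_def Z_def)
    from this[of _ 1] this[of _ "-1"] have "r0 1 g = 0" if "g \<in> G" for g
      using that by (force simp: r0_def)
    hence "r0 1 x = 0" for x by (rule zero_on_G_imp_zero[OF a])
    thus "\<exists>A B. A \<noteq> 0 \<and> (\<forall>x. A * r x = B * q x)"
      using q\<alpha> by (intro exI[of _ "q \<alpha>"] exI[of _ "r \<alpha>"]) (simp add: r0_def)
  qed
  thus ?thesis using q by (auto simp: Q_def)
qed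

text \<open>
  The values of \<open>q\<close> form a subgroup of the integers; \<open>d\<close> is its positive generator.
\<close>

lemma primitive_multiple:
  fixes q :: "'m \<Rightarrow> int"
  assumes q: "additive q" "q z \<noteq> 0"
  obtains d \<rho> m where "d > 0" "additive \<rho>" "\<And>x. q x = d * \<rho> x" "\<rho> m = 1"
proof -
  define P where "P d \<longleftrightarrow> d > 0 \<and> (\<exists>m. q m = int d)" for d
  have "P (nat \<bar>q z\<bar>)"
    using q(2) additive.minus[OF q(1), of z] by (auto simp: P_def abs_if intro: exI[of _ "- z"])
  hence P: "P (Least P)" by (rule LeastI)
  define d where "d = int (Least P)"
  obtain m where d: "d > 0" and m: "q m = d" using P by (auto simp: P_def d_def)
  have dvd: "d dvd q x" for x
  proof (rule ccontr)
    assume "\<not> d dvd q x"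
    hence pos: "q x mod d > 0" using d by (simp add: dvd_eq_mod_eq_0 order_less_le)
    have "q (x - int_mult (q x div d) m) = q x mod d"
      by (simp add: additive.diff[OF q(1)] additive_int_mult[OF q(1)] m minus_div_mult_eq_mod)
    hence "P (nat (q x mod d))" using pos unfolding P_def by auto
    hence "Least P \<le> nat (q x mod d)" by (rule Least_le)
    moreover have "q x mod d < d" using d by simp
    ultimately show False using pos by (simp add: d_def)
  qed
  show thesis
  proof (rule that[of d "\<lambda>x. q x div d" m])
    show "additive (\<lambda>x. q x div d)"
      by unfold_locales (simp add: additive.add[OF q(1)] dvd)
  qed (use d m dvd in auto)
qed

text \<open>
  The primitive functional \<open>\<rho>\<close> below \<open>q\<close> generates a face: if \<open>x + y\<close> is a multiple of \<open>\<rho>\<close> with \<open>x\<close>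
  and \<open>y\<close> in the dual semigroup, then \<open>x\<close> vanishes at all zeros of \<open>q\<close> among the generators, because
  both summands are nonnegative there, and is therefore a rational multiple of \<open>\<rho>\<close>. Primitivity
  makes the factor an integer, and a generator with \<open>\<rho> > 0\<close> makes it nonnegative.
\<close>

lemma facet_functional_ray:
  assumes q: "q \<in> dual_semigroup S" "facet_functional G q" "q z \<noteq> 0"
  shows "\<exists>\<rho>\<in>dual_rays S. \<exists>d>0. \<forall>x. q x = d * \<rho> x"
proof -
  have "additive q" using q(1) by (simp add: dual_semigroup_iff)
  then obtain d \<rho> m where d: "d > 0" and \<rho>: "additive \<rho>" "\<And>x. q x = d * \<rho> x" "\<rho> m = 1"
    using primitive_multiple[of q z] q(3) by metis
  have \<rho>S: "\<rho> \<in> dual_semigroup S"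
    using q(1) d \<rho> by (auto simp: dual_semigroup_iff zero_le_mult_iff)
  have "\<exists>g\<in>G. \<rho> g \<noteq> 0" using zero_on_G_imp_zero[OF \<rho>(1)] \<rho>(3) by fastforce
  then obtain h where h: "h \<in> G" "\<rho> h > 0" using \<rho>S by (force simp: dual_semigroup_iff)
  define F where "F = submonoid hull {\<rho>}"
  have F: "F = range (\<lambda>k m. int k * \<rho> m)" by (simp add: F_def submonoid_hull_functional)
  have summand: "x \<in> F" if xy: "x \<in> dual_semigroup S" "y \<in> dual_semigroup S" "x + y \<in> F" for x y
  proof -
    obtain k where k: "x + y = (\<lambda>m. int k * \<rho> m)" using xy(3) by (auto simp: F)
    have "x g = 0" if "g \<in> G" "q g = 0" for g
    proof -
      have "\<rho> g = 0" using that d \<rho> by simp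
      hence "x g + y g = 0" using fun_cong[OF k, of g] by simp
      thus ?thesis using that xy by (simp add: dual_semigroup_iff add_nonneg_eq_0_iff)
    qed
    then obtain A B where AB: "A \<noteq> 0" "\<And>z. A * x z = B * q z"
      using q(2) xy(1) unfolding facet_functional_def dual_semigroup_iff by blast
    have Axm: "A * x m = B * d" using AB(2)[of m] \<rho> by simp
    have x: "x z = x m * \<rho> z" for z
    proof -
      have "A * x z = B * d * \<rho> z" by (simp only: AB(2) \<rho>(2) mult.assoc)
      also have "\<dots> = A * (x m * \<rho> z)" by (simp only: mult.assoc flip: Axm)
      finally show ?thesis using AB(1) mult_left_cancel by blast
    qed
    have "0 \<le> x h" using h xy(1) by (simp add: dual_semigroup_iff)
    hence "0 \<le> x m * \<rho> h" by (simp only: x[of h])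
    hence "0 \<le> x m" using h by (simp add: zero_le_mult_iff)
    hence "x = (\<lambda>z. int (nat (x m)) * \<rho> z)" by (intro ext, subst x) (simp only: nat_0_le)
    thus "x \<in> F" unfolding F by (rule range_eqI)
  qed
  have "F \<subseteq> dual_semigroup S"
    using \<rho>S additive_lincomb[of \<rho> \<rho> _ 0] by (auto simp: F dual_semigroup_iff)
  hence "semigroup_face F (dual_semigroup S)"
    unfolding semigroup_face_def using summand submonoid_hull[of "{\<rho>}"]
    by (metis F_def add.commute)
  moreover have "bij_betw (\<lambda>k m. int k * \<rho> m) UNIV F"
    unfolding bij_betw_def F
  proof
    show "inj (\<lambda>k m. int k * \<rho> m)"
      by (rule injI, drule fun_cong[of _ _ m]) (simp add: \<rho>)
  qed simp
  moreover have "(\<lambda>m. int (k + l) * \<rho> m) = (\<lambda>m. int k * \<rho> m) + (\<lambda>m. int l * \<rho> m)" for k l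
    by (rule ext) (simp add: distrib_right)
  ultimately have "semigroup_ray F (dual_semigroup S)"
    unfolding semigroup_ray_def by blast
  hence "\<rho> \<in> dual_rays S" unfolding dual_rays_def F_def by blast
  thus ?thesis using d \<rho> by blast
qed

text \<open>
  Together with nonnegativity of the rays on \<open>S\<close>, this says that the rays of the dual semigroup
  define \<open>S\<close>.
\<close>

lemma in_S_if_rays_nonneg:
  assumes "\<And>\<rho>. \<rho> \<in> dual_rays S \<Longrightarrow> 0 \<le> \<rho> \<alpha>"
  shows "\<alpha> \<in> S"
proof (rule ccontr)
  assume "\<alpha> \<notin> S"
  then obtain q where q: "q \<in> dual_semigroup S" "q \<alpha> < 0" "facet_functional G q"
    using separating_facet by blast
  then obtain \<rho> d where "\<rho> \<in> dual_rays S" "d > 0" "q \<alpha> = d * \<rho> \<alpha>"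
    using facet_functional_ray[of q \<alpha>] by force
  thus False using assms q(2) by (force simp: mult_less_0_iff)
qed

text \<open>
  What remains of the definition of a ray: the summand rule is the face property, read for
  functions instead of members of a set of multiples.
\<close>

lemma dual_raysD:
  assumes "\<rho> \<in> dual_rays S"
  shows ray_additive: "additive \<rho>"
    and ray_nonneg: "m \<in> S \<Longrightarrow> 0 \<le> \<rho> m"
    and ray_nonzero: "\<exists>x. \<rho> x \<noteq> 0"
    and ray_summand: "x \<in> dual_semigroup S \<Longrightarrow> y \<in> dual_semigroup S \<Longrightarrow>
           (\<And>m. x m + y m = int k * \<rho> m) \<Longrightarrow> \<exists>j. \<forall>m. x m = int j * \<rho> m"
proof -
  have ray: "semigroup_ray (range (\<lambda>k m. int k * \<rho> m)) (dual_semigroup S)"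
    using assms by (simp add: dual_rays_def submonoid_hull_functional)
  hence face: "semigroup_face (range (\<lambda>k m. int k * \<rho> m)) (dual_semigroup S)"
    by (simp add: semigroup_ray_def)
  have "\<rho> = (\<lambda>m. int 1 * \<rho> m)" by simp
  hence "\<rho> \<in> range (\<lambda>k m. int k * \<rho> m)" by (rule range_eqI)
  hence \<rho>: "\<rho> \<in> dual_semigroup S" using face by (auto simp: semigroup_face_def)
  thus "additive \<rho>" "m \<in> S \<Longrightarrow> 0 \<le> \<rho> m"
    by (auto simp: dual_semigroup_def dual_lattice_def)
  show "\<exists>x. \<rho> x \<noteq> 0"
  proof (rule ccontr)
    assume "\<nexists>x. \<rho> x \<noteq> 0"
    hence sub: "range (\<lambda>k m. int k * \<rho> m) \<subseteq> {\<lambda>m. 0}" by auto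
    obtain \<psi> :: "nat \<Rightarrow> 'm \<Rightarrow> int" where "bij_betw \<psi> UNIV (range (\<lambda>k m. int k * \<rho> m))"
      using ray by (auto simp: semigroup_ray_def)
    hence "inj \<psi>" "range \<psi> \<subseteq> {\<lambda>m. 0}" using sub by (auto simp: bij_betw_def)
    thus False using finite_subset[of "range \<psi>" "{\<lambda>m. 0}"] range_inj_infinite by auto
  qed
  show "\<exists>j. \<forall>m. x m = int j * \<rho> m"
    if xy: "x \<in> dual_semigroup S" "y \<in> dual_semigroup S" "\<And>m. x m + y m = int k * \<rho> m"
  proof -
    have "x + y = (\<lambda>m. int k * \<rho> m)" using xy(3) by (intro ext) simp
    hence "x + y \<in> range (\<lambda>k m. int k * \<rho> m)" by blast
    hence "x \<in> range (\<lambda>k m. int k * \<rho> m)" using face xy(1,2) unfolding semigroup_face_def by blast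
    thus ?thesis by auto
  qed
qed

lemma ray_in_dual: "\<rho> \<in> dual_rays S \<Longrightarrow> \<rho> \<in> dual_semigroup S"
  using ray_additive ray_nonneg by (simp add: dual_semigroup_def dual_lattice_def)

text \<open>
  If \<open>\<rho> = d \<sigma>\<close>, then \<open>\<sigma>\<close> is a summand of \<open>\<rho>\<close>, so it is a multiple of \<open>\<rho>\<close>; hence \<open>d = 1\<close>.
\<close>

lemma ray_primitive:
  assumes "\<rho> \<in> dual_rays S"
  obtains m where "\<rho> m = 1"
proof -
  obtain z where "\<rho> z \<noteq> 0" using ray_nonzero[OF assms] by blast
  then obtain d \<sigma> m where d: "d > 0" and \<sigma>: "additive \<sigma>" "\<And>x. \<rho> x = d * \<sigma> x" "\<sigma> m = 1"
    using primitive_multiple[OF ray_additive[OF assms]] by metis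
  have "\<sigma> \<in> dual_semigroup S" "(\<lambda>x. (d - 1) * \<sigma> x + 0 * \<sigma> x) \<in> dual_semigroup S"
    using ray_in_dual[OF assms] d \<sigma> additive_lincomb[of \<sigma> \<sigma> "d - 1" 0]
    by (auto simp: dual_semigroup_iff zero_le_mult_iff)
  from ray_summand[OF assms this, of 1] obtain j where "\<And>x. \<sigma> x = int j * \<rho> x"
    by (auto simp: \<sigma>(2) algebra_simps)
  hence "1 = int j * \<rho> m" using \<sigma>(3) by metis
  hence "\<rho> m = 1 \<or> \<rho> m = -1" by (auto simp: eq_commute[of 1] zmult_eq_1_iff)
  hence "\<rho> m = 1" using d \<sigma>(2)[of m] \<sigma>(3) by auto
  thus thesis by (rule that)
qed

text \<open>
  For large \<open>N\<close> both \<open>N \<rho> + r\<close> and \<open>N \<rho> - r\<close> are nonnegative on the generators, and their sum is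
  the multiple \<open>2 N \<rho>\<close> of \<open>\<rho>\<close>. The face property makes each of them a multiple of \<open>\<rho>\<close>.
\<close>

lemma ray_annihilator_int:
  fixes r :: "'m \<Rightarrow> int"
  assumes \<rho>: "\<rho> \<in> dual_rays S" and r: "additive r" "\<And>g. g \<in> G \<Longrightarrow> \<rho> g = 0 \<Longrightarrow> r g = 0"
  shows "\<exists>k. \<forall>x. r x = k * \<rho> x"
proof -
  define N where "N = (\<Sum>g\<in>G. nat \<bar>r g\<bar>)"
  have N: "\<bar>r g\<bar> \<le> int N * \<rho> g" if "g \<in> G" for g
  proof (cases "\<rho> g = 0")
    case False
    hence "1 \<le> \<rho> g" using ray_nonneg[OF \<rho>, of g] that G_subset by auto
    moreover have "nat \<bar>r g\<bar> \<le> N" unfolding N_def using finite_G that by (intro member_le_sum) auto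
    ultimately have "\<bar>r g\<bar> * 1 \<le> int N * \<rho> g" by (intro mult_mono) auto
    thus ?thesis by simp
  qed (use r that in auto)
  have "(\<lambda>x. int N * \<rho> x + c * r x) \<in> dual_semigroup S" if "c = 1 \<or> c = -1" for c
    using that N additive_lincomb[OF ray_additive[OF \<rho>] r(1), of "int N" c]
    by (force simp: dual_semigroup_iff)
  from ray_summand[OF \<rho> this[of 1] this[of "-1"], of "2 * N"] obtain j where
    j: "\<forall>x. int N * \<rho> x + 1 * r x = int j * \<rho> x" by auto
  hence "\<forall>x. int N * \<rho> x + r x = int j * \<rho> x" by simp
  thus ?thesis by (intro exI[of _ "int j - int N"]) (simp add: left_diff_distrib eq_diff_eq add.commute)
qed

text \<open>
  Reduction to the integral case: by the Farkas lemma for the zeros of \<open>\<rho>\<close> among the generators and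
  their negatives, every \<open>x\<close> with \<open>\<rho> x = 0\<close> has a positive multiple in the group that they
  generate, since a separating functional would vanish on the zeros and thus be a multiple of \<open>\<rho>\<close>.
  So \<open>p\<close> vanishes wherever \<open>\<rho>\<close> does, and it is determined by its value at a point with \<open>\<rho> = 1\<close>.
\<close>

lemma ray_annihilator:
  fixes p :: "'m \<Rightarrow> 'k::field_char_0"
  assumes \<rho>: "\<rho> \<in> dual_rays S" and p: "additive p" "\<And>m. m \<in> S \<Longrightarrow> \<rho> m = 0 \<Longrightarrow> p m = 0"
  shows "\<exists>c. \<forall>x. p x = c * of_int (\<rho> x)"
proof -
  note \<rho>a = ray_additive[OF \<rho>]
  define Z where "Z = {g \<in> G. \<rho> g = 0}"
  have finZ: "finite (Z \<union> uminus ` Z)" using finite_G by (simp add: Z_def)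
  have pZ: "p g = 0" if "g \<in> Z \<union> uminus ` Z" for g
    using that p G_subset by (auto simp: Z_def additive.minus[OF p(1)])
  have perp: "p x = 0" if "\<rho> x = 0" for x
    using Farkas[OF finZ, of x]
  proof (elim disjE exE conjE)
    fix N assume "N > 0" "int_mult N x \<in> submonoid hull (Z \<union> uminus ` Z)"
    hence "p (int_mult N x) = 0" by (intro submonoid_hull_zero[OF p(1) pZ])
    hence "of_int N * p x = 0" by (simp only: additive_int_mult[OF p(1)])
    thus ?thesis using \<open>N > 0\<close> by simp
  next
    fix r :: "'m \<Rightarrow> int" assume r: "additive r" "\<forall>g\<in>Z \<union> uminus ` Z. 0 \<le> r g" "r x < 0"
    have "r g = 0" if "g \<in> G" "\<rho> g = 0" for g
      using r(2)[rule_format, of g] r(2)[rule_format, of "- g"] that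
      by (simp add: Z_def additive.minus[OF r(1)])
    then obtain k where "\<forall>y. r y = k * \<rho> y" using ray_annihilator_int[OF \<rho> r(1)] by blast
    thus ?thesis using r(3) that by simp
  qed
  obtain m where m: "\<rho> m = 1" by (rule ray_primitive[OF \<rho>])
  have "p x = p m * of_int (\<rho> x)" for x
  proof -
    have "p (x - int_mult (\<rho> x) m) = 0"
      by (rule perp) (simp add: additive.diff[OF \<rho>a] additive_int_mult[OF \<rho>a] m)
    thus ?thesis by (simp add: additive.diff[OF p(1)] additive_int_mult[OF p(1)] mult.commute)
  qed
  thus ?thesis by blast
qed

text \<open>
  Start from a lattice point \<open>m\<close> with \<open>\<rho> m = 1\<close>. No functional that is nonnegative on the generators
  and zero on the facet is negative at \<open>m\<close>, as it is a nonnegative multiple of \<open>\<rho>\<close>. By the Farkas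
  lemma some \<open>N m\<close> lies in \<open>S\<close> up to subtracting an element \<open>t\<close> of the facet. Then \<open>N (m + t)\<close> is in
  \<open>S\<close>, and so is \<open>m + t\<close> by saturation.
\<close>

lemma ray_height_one:
  assumes \<rho>: "\<rho> \<in> dual_rays S"
  obtains m where "m \<in> S" "\<rho> m = 1"
proof -
  note \<rho>a = ray_additive[OF \<rho>]
  obtain m where m: "\<rho> m = 1" by (rule ray_primitive[OF \<rho>])
  define Z where "Z = {g \<in> G. \<rho> g = 0}"
  have Z: "Z \<subseteq> G" "finite Z" using finite_G by (auto simp: Z_def)
  have "\<exists>N>0. int_mult N m \<in> submonoid hull (G \<union> uminus ` Z)"
  proof (rule ccontr)
    assume *: "\<not> ?thesis"
    have "finite (G \<union> uminus ` Z)" using finite_G Z by simp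
    from Farkas[OF this, of m] *
    obtain r :: "'m \<Rightarrow> int" where r: "additive r" "\<forall>g\<in>G \<union> uminus ` Z. 0 \<le> r g" "r m < 0"
      by blast
    have "r g = 0" if "g \<in> G" "\<rho> g = 0" for g
      using r(2)[rule_format, of g] r(2)[rule_format, of "- g"] that
      by (simp add: Z_def additive.minus[OF r(1)])
    then obtain k where k: "\<And>y. r y = k * \<rho> y" using ray_annihilator_int[OF \<rho> r(1)] by blast
    obtain s t where st: "s \<in> S" "t \<in> S" "m = s - t" using differences by blast
    hence "\<rho> s = \<rho> t + 1" using m by (simp add: additive.diff[OF \<rho>a])
    hence "\<rho> s > 0" using ray_nonneg[OF \<rho> st(2)] by simp
    moreover have "0 \<le> r s" using submonoid_hull_nonneg[OF r(1), of G s] r(2) st(1) by (simp add: S_eq)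
    ultimately have "0 \<le> k" using k[of s] by (simp add: zero_le_mult_iff)
    thus False using r(3) k[of m] m by simp
  qed
  then obtain N where N: "N > 0" "int_mult N m \<in> submonoid hull (G \<union> uminus ` Z)" by blast
  have "\<exists>t\<in>S. \<rho> t = 0 \<and> y + t \<in> S" if "y \<in> submonoid hull (G \<union> uminus ` Z)" for y
    using that
  proof (rule hull_induct)
    fix x assume "x \<in> G \<union> uminus ` Z"
    thus "\<exists>t\<in>S. \<rho> t = 0 \<and> x + t \<in> S"
    proof
      assume "x \<in> G"
      thus ?thesis using G_subset submonoid_zero[OF submonoid_S] additive.zero[OF \<rho>a]
        by (intro bexI[of _ 0]) auto
    next
      assume "x \<in> uminus ` Z"
      thus ?thesis using G_subset submonoid_zero[OF submonoid_S]
        by (intro bexI[of _ "- x"]) (auto simp: Z_def)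
    qed
  next
    show "submonoid {y. \<exists>t\<in>S. \<rho> t = 0 \<and> y + t \<in> S}"
      unfolding submonoid_def
    proof (intro conjI ballI CollectI)
      show "\<exists>t\<in>S. \<rho> t = 0 \<and> 0 + t \<in> S"
        using submonoid_zero[OF submonoid_S] additive.zero[OF \<rho>a] by auto
    next
      fix x y assume "x \<in> {y. \<exists>t\<in>S. \<rho> t = 0 \<and> y + t \<in> S}" "y \<in> {y. \<exists>t\<in>S. \<rho> t = 0 \<and> y + t \<in> S}"
      then obtain s t where st: "s \<in> S" "t \<in> S" "\<rho> s = 0" "\<rho> t = 0" "x + s \<in> S" "y + t \<in> S" by blast
      have "x + y + (s + t) = (x + s) + (y + t)" by (simp add: add_ac)
      also have "\<dots> \<in> S" using st by (intro submonoid_add[OF submonoid_S, of "x + s" "y + t"])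
      finally show "\<exists>t\<in>S. \<rho> t = 0 \<and> x + y + t \<in> S"
        using st submonoid_add[OF submonoid_S]
        by (intro bexI[of _ "s + t"]) (auto simp: additive.add[OF \<rho>a])
    qed
  qed
  then obtain t where t: "t \<in> S" "\<rho> t = 0" "int_mult N m + t \<in> S" using N(2) by blast
  have "int_mult N (m + t) = (int_mult N m + t) + int_mult (N - 1) t"
    by (simp add: int_mult.scale_right_distrib int_mult.scale_left_diff_distrib)
  also have "\<dots> \<in> S"
  proof (rule submonoid_add[OF submonoid_S t(3)])
    show "int_mult (N - 1) t \<in> S" using t N(1) by (intro submonoid_int_mult[OF submonoid_S]) auto
  qed
  finally have "m + t \<in> S" by (rule divisible[OF N(1)])
  moreover have "\<rho> (m + t) = 1" using m t by (simp add: additive.add[OF \<rho>a])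
  ultimately show thesis by (rule that)
qed

text \<open>
  Proportional rays take the value one on \<open>S\<close> at some points \<open>m\<close> and \<open>m'\<close>; comparing there shows that
  \<open>\<rho>' m\<close> and \<open>\<rho> m'\<close> are inverse to each other, and both are nonnegative integers.
\<close>

lemma rays_proportional_eq:
  assumes "\<rho> \<in> dual_rays S" "\<rho>' \<in> dual_rays S" "c \<noteq> 0"
    and "\<And>x. c * of_int (\<rho> x) = c' * (of_int (\<rho>' x) :: 'k::field_char_0)"
  shows "\<rho> = \<rho>'"
proof -
  obtain m where m: "m \<in> S" "\<rho> m = 1" by (rule ray_height_one[OF assms(1)])
  obtain m' where m': "m' \<in> S" "\<rho>' m' = 1" by (rule ray_height_one[OF assms(2)])
  have c: "c = c' * of_int (\<rho>' m)" using assms(4)[of m] m by simp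
  hence "c' \<noteq> 0" using assms(3) by auto
  have "c * of_int (\<rho> m') = c'" using assms(4)[of m'] m' by simp
  hence "c' * (of_int (\<rho>' m * \<rho> m') :: 'k) = c' * of_int 1" using c by (simp add: mult_ac)
  hence "\<rho>' m * \<rho> m' = 1"
    using \<open>c' \<noteq> 0\<close> mult_left_cancel of_int_eq_iff by metis
  hence "\<rho>' m = 1" using ray_nonneg[OF assms(2) m(1)] by (auto simp: zmult_eq_1_iff)
  hence "c = c'" using c by simp
  thus ?thesis using assms(3,4) by (intro ext) simp
qed

end

section \<open>The semigroup algebra\<close>

abbreviation lookup where "lookup \<equiv> Poly_Mapping.lookup"
abbreviation keys where "keys \<equiv> Poly_Mapping.keys"
abbreviation single where "single \<equiv> Poly_Mapping.single"

lemma sum_monomials: "f = (\<Sum>m\<in>keys f. single m (lookup f m))"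
  by (rule poly_mapping_eqI) (auto simp: lookup_sum lookup_single when_def sum.delta in_keys_iff)

lemma lookup_scal: "lookup (scal c f) m = c * lookup f m"
  unfolding scal_def by (simp flip: mult_map_scale_conv_mult add: Poly_Mapping.map.rep_eq when_def)

lemma scal_single: "scal c (single m d) = single m (c * d)"
  by (simp add: scal_def mult_single)

lemma keys_scal: "keys (scal c f) \<subseteq> keys f"
  by (auto simp: in_keys_iff lookup_scal)

lemma semigroup_algebra_iff: "f \<in> semigroup_algebra S \<longleftrightarrow> keys f \<subseteq> S"
  by (simp add: semigroup_algebra_def)

lemma lookup_mult_monom: "lookup (f * monom_x m) (k + m) = lookup f k"
  for f :: "'m::ab_group_add \<Rightarrow>\<^sub>0 'k::field_char_0"
proof -
  have "f * monom_x m = (\<Sum>x\<in>keys f. single (x + m) (lookup f x))"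
    by (subst sum_monomials[of f]) (simp add: sum_distrib_right mult_single)
  thus ?thesis
    by (auto simp: lookup_sum lookup_single when_def sum.delta in_keys_iff)
qed

lemma keys_add_subset: "keys f \<subseteq> T \<Longrightarrow> keys g \<subseteq> T \<Longrightarrow> keys (f + g) \<subseteq> T"
  using keys_add[of f g] by blast

lemma keys_sum_subset: "(\<And>i. i \<in> A \<Longrightarrow> keys (f i) \<subseteq> T) \<Longrightarrow> keys (sum f A) \<subseteq> T"
  using keys_sum[of f A] by blast

section \<open>Homogeneous derivations\<close>

text \<open>
  Linearity of \<open>\<partial>\<^bsub>\<alpha>,p\<^esub>\<close> is read off from its coefficients, as the summation range in its definition
  varies with \<open>f\<close>.
\<close>

lemma lookup_hom_der:
  assumes "f \<in> semigroup_algebra S"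
  shows "lookup (hom_der S \<alpha> p f) k = lookup f (k - \<alpha>) * p (k - \<alpha>)"
  using assms
  by (auto simp: hom_der_def lookup_sum lookup_single when_def sum.delta in_keys_iff
      eq_diff_eq[symmetric] cong: if_cong)

lemma keys_hom_der:
  assumes "\<And>m. m \<in> T \<Longrightarrow> p m \<noteq> 0 \<Longrightarrow> m + \<alpha> \<in> T'" "T \<subseteq> S" "keys f \<subseteq> T"
  shows "keys (hom_der S \<alpha> p f) \<subseteq> T'"
proof
  fix k assume "k \<in> keys (hom_der S \<alpha> p f)"
  moreover have "f \<in> semigroup_algebra S" using assms by (auto simp: semigroup_algebra_iff)
  ultimately have "k - \<alpha> \<in> keys f" "p (k - \<alpha>) \<noteq> 0" by (auto simp: in_keys_iff lookup_hom_der)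
  with assms(3) assms(1)[of "k - \<alpha>"] show "k \<in> T'" by auto
qed

text \<open>
  By bilinearity the Leibniz rule is checked on monomials, where it is the additivity of \<open>p\<close>.
  The last hypothesis keeps the image inside \<open>\<k>[S]\<close>.
\<close>

lemma hom_der_derivation:
  fixes p :: "'m::ab_group_add \<Rightarrow> 'k::field_char_0"
  assumes S: "submonoid S" and p: "\<And>x y. p (x + y) = p x + p y"
    and stable: "\<And>m. m \<in> S \<Longrightarrow> p m \<noteq> 0 \<Longrightarrow> m + \<alpha> \<in> S"
  shows "hom_der S \<alpha> p \<in> derivations S"
proof -
  let ?A = "semigroup_algebra S :: ('m \<Rightarrow>\<^sub>0 'k) set" and ?D = "hom_der S \<alpha> p"
  have add: "f + g \<in> ?A" "?D (f + g) = ?D f + ?D g" if "f \<in> ?A" "g \<in> ?A" for f g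
  proof -
    show *: "f + g \<in> ?A" using that by (simp add: semigroup_algebra_iff keys_add_subset)
    show "?D (f + g) = ?D f + ?D g"
      using that * by (intro poly_mapping_eqI) (simp add: lookup_hom_der lookup_add distrib_right)
  qed
  have sum: "sum f X \<in> ?A \<and> ?D (sum f X) = (\<Sum>i\<in>X. ?D (f i))" if "\<And>i. i \<in> X \<Longrightarrow> f i \<in> ?A"
    for f and X :: "'i set"
    using that
    by (induction X rule: infinite_finite_induct)
      (auto simp: add semigroup_algebra_iff[of 0] intro!: poly_mapping_eqI simp: lookup_hom_der)
  have "?D (f * g) = ?D f * g + f * ?D g" if fg: "f \<in> ?A" "g \<in> ?A" for f g
  proof -
    have kS: "single m c \<in> ?A" if "m \<in> S" for m c
      using that by (auto simp: semigroup_algebra_iff)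
    have D: "?D (single m c) = single (m + \<alpha>) (c * p m)" if "m \<in> S" for m c
      using kS[OF that] by (auto simp: hom_der_def)
    have f: "f = (\<Sum>m\<in>keys f. single m (lookup f m))" and g: "g = (\<Sum>m\<in>keys g. single m (lookup g m))"
      by (fact sum_monomials)+
    have sub: "keys f \<subseteq> S" "keys g \<subseteq> S" using fg by (auto simp: semigroup_algebra_iff)
    define u where "u = (\<lambda>m n. single m (lookup f m) * single n (lookup g n))"
    have u: "u m n \<in> ?A"
      "?D (u m n) = ?D (single m (lookup f m)) * single n (lookup g n)
                  + single m (lookup f m) * ?D (single n (lookup g n))"
      if "m \<in> keys f" "n \<in> keys g" for m n
    proof -
      have mn: "m \<in> S" "n \<in> S" "m + n \<in> S" using that sub S by (auto simp: submonoid_def)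
      show "u m n \<in> ?A" using mn(3) by (simp add: u_def mult_single kS)
      show "?D (u m n) = ?D (single m (lookup f m)) * single n (lookup g n)
                  + single m (lookup f m) * ?D (single n (lookup g n))"
        using mn by (simp add: u_def mult_single D p algebra_simps flip: single_add)
    qed
    have expand: "?D h = (\<Sum>m\<in>keys h. ?D (single m (lookup h m)))" if "h \<in> ?A" for h
    proof -
      have "\<And>m. m \<in> keys h \<Longrightarrow> single m (lookup h m) \<in> ?A"
        using kS that by (auto simp: semigroup_algebra_iff)
      hence "?D (\<Sum>m\<in>keys h. single m (lookup h m)) = (\<Sum>m\<in>keys h. ?D (single m (lookup h m)))"
        by (rule sum[THEN conjunct2])
      thus ?thesis by (simp only: sum_monomials[symmetric])
    qed
    note Df = expand[OF fg(1)] and Dg = expand[OF fg(2)]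
    have "f * g = (\<Sum>m\<in>keys f. \<Sum>n\<in>keys g. u m n)"
      by (subst f, subst g) (simp only: u_def sum_product)
    also have "?D \<dots> = (\<Sum>m\<in>keys f. \<Sum>n\<in>keys g. ?D (u m n))"
      using sum[of "keys f" "\<lambda>m. \<Sum>n\<in>keys g. u m n"] sum[of "keys g" "u m" for m] u(1)
      by (simp cong: sum.cong)
    also have "\<dots> = (\<Sum>m\<in>keys f. \<Sum>n\<in>keys g. ?D (single m (lookup f m)) * single n (lookup g n))
                + (\<Sum>m\<in>keys f. \<Sum>n\<in>keys g. single m (lookup f m) * ?D (single n (lookup g n)))"
      using u(2) by (simp add: sum.distrib)
    also have "\<dots> = ?D f * g + f * ?D g"
      unfolding sum_product[symmetric] Df[symmetric] Dg[symmetric] f[symmetric] g[symmetric] ..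
    finally show ?thesis .
  qed
  moreover have "?D f \<in> ?A" if "f \<in> ?A" for f
    using keys_hom_der[of S p \<alpha> S S f] stable that by (auto simp: semigroup_algebra_iff)
  moreover have "?D (scal c f) = scal c (?D f)" if "f \<in> ?A" for c f
  proof -
    have "scal c f \<in> ?A" using that keys_scal[of c f] by (auto simp: semigroup_algebra_iff)
    thus ?thesis using that
      by (intro poly_mapping_eqI) (simp add: lookup_hom_der lookup_scal mult.assoc)
  qed
  ultimately show ?thesis using add(2) by (auto simp: derivations_def hom_der_def)
qed

lemma derivationD:
  assumes "D \<in> derivations S"
  shows derivation_outside: "f \<notin> semigroup_algebra S \<Longrightarrow> D f = 0"
    and derivation_closed: "f \<in> semigroup_algebra S \<Longrightarrow> D f \<in> semigroup_algebra S"
    and derivation_add: "f \<in> semigroup_algebra S \<Longrightarrow> g \<in> semigroup_algebra S \<Longrightarrow> D (f + g) = D f + D g"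
    and derivation_scal: "f \<in> semigroup_algebra S \<Longrightarrow> D (scal c f) = scal c (D f)"
    and derivation_mult: "f \<in> semigroup_algebra S \<Longrightarrow> g \<in> semigroup_algebra S \<Longrightarrow>
           D (f * g) = D f * g + f * D g"
  using assms by (auto simp: derivations_def)

lemma scal_add: "scal c (f + g) = scal c f + scal c g"
  by (simp add: scal_def distrib_left)

lemma derivations_zero: "0 \<in> derivations S"
  by (auto simp: derivations_def semigroup_algebra_def scal_def)

lemma derivations_add:
  fixes D E :: "('m::ab_group_add, 'k::field_char_0) operator"
  assumes D: "D \<in> derivations S" and E: "E \<in> derivations S"
  shows "D + E \<in> derivations S"
  unfolding derivations_def
proof (intro CollectI conjI allI ballI impI)
  fix f :: "'m \<Rightarrow>\<^sub>0 'k" assume "f \<notin> semigroup_algebra S"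
  thus "(D + E) f = 0" by (simp add: derivation_outside[OF D] derivation_outside[OF E])
next
  fix f g :: "'m \<Rightarrow>\<^sub>0 'k" and c assume f: "f \<in> semigroup_algebra S"
  show "(D + E) f \<in> semigroup_algebra S"
    using f derivation_closed[OF D] derivation_closed[OF E]
    by (simp add: semigroup_algebra_iff keys_add_subset)
  show "(D + E) (scal c f) = scal c ((D + E) f)"
    using f by (simp add: derivation_scal[OF D] derivation_scal[OF E] scal_add)
  assume g: "g \<in> semigroup_algebra S"
  show "(D + E) (f + g) = (D + E) f + (D + E) g"
    using f g by (simp add: derivation_add[OF D] derivation_add[OF E])
  show "(D + E) (f * g) = (D + E) f * g + f * (D + E) g"
    using f g by (simp add: derivation_mult[OF D] derivation_mult[OF E] algebra_simps)
qed

lemma derivations_sum: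
  "(\<And>i. i \<in> X \<Longrightarrow> D i \<in> derivations S) \<Longrightarrow> sum D X \<in> derivations S"
  by (induction X rule: infinite_finite_induct) (auto simp: derivations_zero derivations_add)

lemma derivation_expand:
  assumes D: "D \<in> derivations S" and f: "f \<in> semigroup_algebra S"
  shows "D f = (\<Sum>m\<in>keys f. scal (lookup f m) (D (monom_x m)))"
proof -
  have zero: "D 0 = 0"
    using derivation_add[OF D, of 0 0] by (simp add: semigroup_algebra_iff)
  have "sum h X \<in> semigroup_algebra S \<and> D (sum h X) = (\<Sum>i\<in>X. D (h i))"
    if "\<And>i. i \<in> X \<Longrightarrow> h i \<in> semigroup_algebra S" for h and X :: "'a set"
    using that
    by (induction X rule: infinite_finite_induct)
      (auto simp: zero derivation_add[OF D] semigroup_algebra_iff keys_add_subset)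
  from this[of "keys f" "\<lambda>m. single m (lookup f m)"]
  have "D f = (\<Sum>m\<in>keys f. D (single m (lookup f m)))"
    using f by (force simp: semigroup_algebra_iff simp flip: sum_monomials split: if_splits)
  also have "\<dots> = (\<Sum>m\<in>keys f. D (scal (lookup f m) (monom_x m)))" by (simp add: scal_single)
  also have "\<dots> = (\<Sum>m\<in>keys f. scal (lookup f m) (D (monom_x m)))"
    using f by (intro sum.cong refl derivation_scal[OF D]) (auto simp: semigroup_algebra_iff)
  finally show ?thesis .
qed

lemma derivation_eqI:
  assumes "D \<in> derivations S" "E \<in> derivations S" "\<And>m. m \<in> S \<Longrightarrow> D (monom_x m) = E (monom_x m)"
  shows "D = E"
proof
  fix f show "D f = E f"
  proof (cases "f \<in> semigroup_algebra S")
    case True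
    have "D f = (\<Sum>m\<in>keys f. scal (lookup f m) (D (monom_x m)))"
      by (rule derivation_expand[OF assms(1) True])
    also have "\<dots> = (\<Sum>m\<in>keys f. scal (lookup f m) (E (monom_x m)))"
      using True assms(3) by (intro sum.cong) (auto simp: semigroup_algebra_iff)
    also have "\<dots> = E f" by (rule derivation_expand[OF assms(2) True, symmetric])
    finally show ?thesis .
  qed (use assms in \<open>simp add: derivation_outside\<close>)
qed

section \<open>Monomial ideals\<close>

text \<open>
  The exponents of the monomials in the ideal are those in \<open>\<Union>\<^sub>i (a i + S)\<close>, and the ideal is
  their span.
\<close>

lemma monomial_ideal_iff:
  assumes S: "submonoid S" and a: "\<forall>i\<in>{1..l}. a i \<in> S"
  shows "f \<in> monomial_ideal S l a \<longleftrightarrow> keys f \<subseteq> {a i + s | i s. i \<in> {1..l} \<and> s \<in> S}"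
proof -
  define E where "E = {a i + s | i s. i \<in> {1..l} \<and> s \<in> S}"
  let ?X = "(\<lambda>i. monom_x (a i)) ` {1..l} :: ('a \<Rightarrow>\<^sub>0 'b) set"
  have E: "E \<subseteq> S" using S a by (auto simp: submonoid_def E_def)
  have SE: "x + y \<in> E" if x: "x \<in> S" and y: "y \<in> E" for x y
  proof -
    obtain i s where "i \<in> {1..l}" "s \<in> S" "y = a i + s" using y unfolding E_def by blast
    moreover have "x + (a i + s) = a i + (x + s)" by (simp add: add_ac)
    ultimately show ?thesis using x S unfolding submonoid_def E_def by blast
  qed
  have "ideal_of S hull ?X = {f. keys f \<subseteq> E}"
  proof (rule hull_unique)
    show "?X \<subseteq> {f. keys f \<subseteq> E}"
    proof safe
      fix i x assume "i \<in> {1..l}" "x \<in> keys (monom_x (a i) :: 'a \<Rightarrow>\<^sub>0 'b)"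
      thus "x \<in> E" unfolding E_def
        using S by (intro CollectI exI[of _ i] exI[of _ 0]) (auto simp: submonoid_def)
    qed
    have "keys (f * g) \<subseteq> E" if "keys f \<subseteq> S" "keys g \<subseteq> E" for f g :: "'a \<Rightarrow>\<^sub>0 'b"
    proof
      fix k assume "k \<in> keys (f * g)"
      then obtain x y where "k = x + y" "x \<in> keys f" "y \<in> keys g" using keys_mult[of f g] by blast
      thus "k \<in> E" using SE[of x y] that by blast
    qed
    thus "ideal_of S {f :: 'a \<Rightarrow>\<^sub>0 'b. keys f \<subseteq> E}"
      using E by (simp add: ideal_of_def semigroup_algebra_def submonoid_def keys_add_subset) blast
  next
    fix J :: "('a \<Rightarrow>\<^sub>0 'b) set" assume J: "?X \<subseteq> J" "ideal_of S J"
    show "{f. keys f \<subseteq> E} \<subseteq> J"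
    proof
      fix f :: "'a \<Rightarrow>\<^sub>0 'b" assume f: "f \<in> {f. keys f \<subseteq> E}"
      have monomials: "single m c \<in> J" if m: "m \<in> E" for m c
      proof -
        obtain i s where js: "i \<in> {1..l}" "s \<in> S" "m = a i + s" using m unfolding E_def by blast
        hence "single s c \<in> semigroup_algebra S" "monom_x (a i) \<in> J"
          using J(1) by (auto simp: semigroup_algebra_iff)
        hence "single s c * monom_x (a i) \<in> J" using J(2) by (simp add: ideal_of_def)
        thus ?thesis by (simp add: mult_single js add.commute)
      qed
      have sums: "sum h K \<in> J" if "\<And>k. k \<in> K \<Longrightarrow> h k \<in> J" for h and K :: "'a set"
        using that J(2) unfolding ideal_of_def submonoid_def
        by (induction K rule: infinite_finite_induct) auto
      have "(\<Sum>m\<in>keys f. single m (lookup f m)) \<in> J"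
        using f by (intro sums monomials) auto
      thus "f \<in> J" by (simp flip: sum_monomials)
    qed
  qed
  thus ?thesis by (simp add: monomial_ideal_def E_def)
qed

section \<open>The lattice and the saturated semigroup\<close>

lemma dual_lattice_over_of_int:
  "additive q \<Longrightarrow> (\<lambda>x. of_int (q x)) \<in> dual_lattice_over"
  unfolding dual_lattice_over_def
  by (intro CollectI exI[of _ "{q}"] exI[of _ "\<lambda>_. 1"]) (simp add: dual_lattice_def)

lemma dual_lattice_over_sum:
  fixes c :: "'i \<Rightarrow> 'k::field_char_0"
  assumes "\<And>i. i \<in> A \<Longrightarrow> additive (q i)"
  shows "(\<lambda>x. \<Sum>i\<in>A. c i * of_int (q i x)) \<in> dual_lattice_over"
  using assms
proof (induction A rule: infinite_finite_induct)
  case (insert i A)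
  have "(\<lambda>x. c i * of_int (q i x)) \<in> dual_lattice_over"
    using insert.prems by (intro dual_lattice_over_scale dual_lattice_over_of_int) simp
  moreover have "(\<lambda>x. \<Sum>i\<in>A. c i * of_int (q i x)) \<in> dual_lattice_over"
    using insert.prems by (intro insert.IH) simp
  ultimately show ?case
    using dual_lattice_over_add insert.hyps by simp
qed (simp_all add: dual_lattice_over_zero)

lemma dual_lattice_over_imp_additive:
  assumes "p \<in> dual_lattice_over" shows "additive p"
proof -
  obtain F c where p: "p = (\<lambda>m. \<Sum>q\<in>F. c q * of_int (q m))" and F: "F \<subseteq> dual_lattice"
    using assms unfolding dual_lattice_over_def by blast
  have add: "q (x + y) = q x + q y" if "q \<in> F" for q x y
    using F that additive.add[of q] by (auto simp: dual_lattice_def)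
  show ?thesis
    unfolding p by unfold_locales (simp add: add distrib_left sum.distrib)
qed

text \<open>
  Dual basis: \<open>p = \<Sum>\<^sub>i p(b\<^sub>i) \<phi>\<^sub>i\<close>, where the \<open>\<phi>\<^sub>i\<close> are the coordinates and the \<open>b\<^sub>i\<close> the
  basis vectors of the lattice.
\<close>

lemma lattice_embedding_additive_in_dual_lattice_over:
  fixes p :: "'m::ab_group_add \<Rightarrow> 'k::field_char_0"
  assumes "lattice_embedding n (\<iota> :: 'm \<Rightarrow> 'v::real_vector)" "additive p"
  shows "p \<in> dual_lattice_over"
proof -
  obtain \<phi> :: "'m \<Rightarrow> nat \<Rightarrow> int" where
    add: "\<And>x y. \<phi> (x + y) = \<phi> x + \<phi> y" and bij: "bij_betw \<phi> UNIV {v. \<forall>i\<ge>n. v i = 0}"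
    using assms(1) unfolding lattice_embedding_def by blast
  have coord: "additive (\<lambda>x. \<phi> x i)" for i by unfold_locales (simp add: add)
  have "\<exists>x. \<phi> x = (\<lambda>j. if j = i then 1 else 0)" if "i < n" for i
  proof -
    have "(\<lambda>j. if j = i then 1 else 0) \<in> {v. \<forall>i\<ge>n. v i = (0::int)}" using that by auto
    thus ?thesis using bij unfolding bij_betw_def by (metis imageE)
  qed
  then obtain b where b: "\<And>i. i < n \<Longrightarrow> \<phi> (b i) = (\<lambda>j. if j = i then 1 else 0)" by metis
  have x: "x = (\<Sum>i<n. int_mult (\<phi> x i) (b i))" for x
  proof -
    have "\<phi> (\<Sum>i<n. int_mult (\<phi> x i) (b i)) j = (\<Sum>i<n. \<phi> x i * \<phi> (b i) j)" for j
      by (simp add: additive.sum[OF coord] additive_int_mult[OF coord])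
    also have "(\<Sum>i<n. \<phi> x i * \<phi> (b i) j) = (\<Sum>i<n. if j = i then \<phi> x i else 0)" for j
      by (intro sum.cong) (auto simp: b)
    also have "(\<Sum>i<n. if j = i then \<phi> x i else 0) = \<phi> x j" for j
      using bij_betwE[OF bij] by (auto simp: sum.delta')
    finally have "\<phi> x = \<phi> (\<Sum>i<n. int_mult (\<phi> x i) (b i))" by auto
    thus ?thesis using bij by (auto simp: bij_betw_def dest: injD)
  qed
  have "p x = (\<Sum>i<n. p (b i) * of_int (\<phi> x i))" for x
    by (subst x) (simp add: additive.sum[OF assms(2)] additive_int_mult[OF assms(2)] mult.commute)
  hence "p = (\<lambda>x. \<Sum>i<n. p (b i) * of_int (\<phi> x i))" by (rule ext)
  thus ?thesis using dual_lattice_over_sum[of "{..<n}" "\<lambda>i x. \<phi> x i" "\<lambda>i. p (b i)"] coord by simp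
qed

text \<open>
  Saturation with respect to the real cone gives the integral form: if \<open>N x\<close> is in \<open>S\<close>, then
  \<open>\<iota> x\<close> is the multiple \<open>1/N\<close> of a point of the cone.
\<close>

lemma saturated_semigroupI:
  fixes \<iota> :: "'m::ab_group_add \<Rightarrow> 'v::real_vector"
  assumes "lattice_embedding n \<iota>" "affine_semigroup S" "minimally_embedded S" "saturated \<iota> S"
  shows "\<exists>G. saturated_semigroup S G"
proof -
  obtain \<phi> :: "'m \<Rightarrow> nat \<Rightarrow> int" and e :: "nat \<Rightarrow> 'v" where
    add: "\<And>x y. \<phi> (x + y) = \<phi> x + \<phi> y" and bij: "bij_betw \<phi> UNIV {v. \<forall>i\<ge>n. v i = 0}"
    and \<iota>: "\<And>m. \<iota> m = (\<Sum>i<n. of_int (\<phi> m i) *\<^sub>R e i)"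
    using assms(1) unfolding lattice_embedding_def by blast
  have coord: "additive (\<lambda>x. \<phi> x i)" for i by unfold_locales (simp add: add)
  obtain G where G: "finite G" "S = submonoid hull G"
    using assms(2) by (auto simp: affine_semigroup_def)
  have S: "submonoid S" by (simp add: G submonoid_hull)
  have "saturated_semigroup S G"
  proof
    fix x :: 'm
    have "subgroup_of {s - t | s t. s \<in> S \<and> t \<in> S}"
      unfolding subgroup_of_def submonoid_def
    proof (intro conjI ballI)
      show "0 \<in> {s - t | s t. s \<in> S \<and> t \<in> S}" using submonoid_zero[OF S] by force
    next
      fix x y assume "x \<in> {s - t | s t. s \<in> S \<and> t \<in> S}" "y \<in> {s - t | s t. s \<in> S \<and> t \<in> S}"
      then obtain s t u v where st: "s \<in> S" "t \<in> S" "u \<in> S" "v \<in> S" "x = s - t" "y = u - v" by blast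
      have "x + y = (s + u) - (t + v)" by (simp add: st(5,6))
      moreover have "s + u \<in> S" "t + v \<in> S" using st submonoid_add[OF S] by blast+
      ultimately show "x + y \<in> {s - t | s t. s \<in> S \<and> t \<in> S}" by blast
    next
      fix x assume "x \<in> {s - t | s t. s \<in> S \<and> t \<in> S}"
      then obtain s t where st: "s \<in> S" "t \<in> S" "x = s - t" by blast
      thus "- x \<in> {s - t | s t. s \<in> S \<and> t \<in> S}"
        by (intro CollectI exI[of _ "t"] exI[of _ "s"]) simp
    qed
    moreover have "S \<subseteq> {s - t | s t. s \<in> S \<and> t \<in> S}"
    proof
      fix s assume "s \<in> S"
      thus "s \<in> {s - t | s t. s \<in> S \<and> t \<in> S}"
        using submonoid_zero[OF S] by (intro CollectI exI[of _ s] exI[of _ 0]) simp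
    qed
    ultimately have "subgroup_of hull S \<subseteq> {s - t | s t. s \<in> S \<and> t \<in> S}"
      by (intro hull_minimal)
    thus "\<exists>s\<in>S. \<exists>t\<in>S. x = s - t" using assms(3) unfolding minimally_embedded_def by blast
  next
    fix x :: 'm assume "x \<noteq> 0"
    moreover have "\<phi> 0 = 0" using add[of 0 0] by simp
    ultimately have "\<phi> x \<noteq> 0" using bij by (metis UNIV_I bij_betw_def inj_onD)
    then obtain i where "\<phi> x i \<noteq> 0" by (auto simp: fun_eq_iff)
    thus "\<exists>q::'m \<Rightarrow> int. additive q \<and> q x \<noteq> 0" using coord by blast
  next
    fix N x assume N: "N > 0" "int_mult N x \<in> S"
    have "\<iota> (int_mult N x) = of_int N *\<^sub>R \<iota> x"
      by (simp add: \<iota> additive_int_mult[OF coord] scaleR_right.sum)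
    hence "\<iota> x = (1 / of_int N) *\<^sub>R \<iota> (int_mult N x)" using N(1) by simp
    moreover have "\<iota> (int_mult N x) \<in> cone_of \<iota> S"
      using N(2) by (simp add: cone_of_def hull_inc)
    ultimately have "\<iota> x \<in> cone_of \<iota> S"
      using N(1) unfolding cone_of_def by (simp add: convex_cone_hull_mul)
    thus "x \<in> S" using assms(4) unfolding saturated_def by blast
  next
    show "finite G" by (fact G(1))
    show "S = submonoid hull G" by (fact G(2))
  qed
  thus ?thesis by (rule exI)
qed

section \<open>Decomposition of derivations\<close>

text \<open>
  The function \<open>p\<close> such that \<open>x\<^sup>m \<mapsto> p(m) x\<^bsup>m+\<alpha>\<^esup>\<close> is the homogeneous part of \<open>D\<close> of degree \<open>\<alpha>\<close>.
\<close>

definition der_coeff ::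
    "('m::ab_group_add, 'k::field_char_0) operator \<Rightarrow> 'm \<Rightarrow> 'm \<Rightarrow> 'k" where
  "der_coeff D \<alpha> m = lookup (D (monom_x m)) (m + \<alpha>)"

lemma der_coeff_add:
  assumes D: "D \<in> derivations S" and S: "m \<in> S" "m' \<in> S"
  shows "der_coeff D \<alpha> (m + m') = der_coeff D \<alpha> m + der_coeff D \<alpha> m'"
proof -
  have "D (monom_x (m + m')) = D (monom_x m * monom_x m')" by (simp add: mult_single)
  also have "\<dots> = D (monom_x m) * monom_x m' + D (monom_x m') * monom_x m"
    using S derivation_mult[OF D, of "monom_x m" "monom_x m'"]
    by (simp add: semigroup_algebra_iff mult.commute)
  finally show ?thesis
    using lookup_mult_monom[of "D (monom_x m)" m' "m + \<alpha>"]
      lookup_mult_monom[of "D (monom_x m')" m "m' + \<alpha>"]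
    by (simp add: der_coeff_def lookup_add add_ac)
qed

lemma der_coeff_sum_hom_der:
  assumes "finite F" "m \<in> S"
  shows "der_coeff (\<Sum>\<alpha>\<in>F. hom_der S \<alpha> (p \<alpha>)) \<beta> m = (if \<beta> \<in> F then p \<beta> m else 0)"
  using assms
  by (simp add: der_coeff_def sum_fun_apply hom_der_monom lookup_sum lookup_single when_def)

lemma derivation_eqI_coeff:
  assumes "D \<in> derivations S" "E \<in> derivations S"
    and eq: "\<And>\<alpha> m. m \<in> S \<Longrightarrow> der_coeff D \<alpha> m = der_coeff E \<alpha> m"
  shows "D = E"
proof (rule derivation_eqI[OF assms(1,2)], rule poly_mapping_eqI)
  fix m k assume "m \<in> S"
  from eq[OF this, of "k - m"] show "lookup (D (monom_x m)) k = lookup (E (monom_x m)) k"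
    by (simp add: der_coeff_def)
qed

context saturated_semigroup
begin

text \<open>
  Every lattice point is a difference of points of \<open>S\<close>, and \<open>p s - p t\<close> depends only on \<open>s - t\<close>.
\<close>

lemma extend_additive:
  fixes p :: "'m \<Rightarrow> 'k::ab_group_add"
  assumes p: "\<And>m m'. m \<in> S \<Longrightarrow> m' \<in> S \<Longrightarrow> p (m + m') = p m + p m'"
  shows "\<exists>P. additive P \<and> (\<forall>m\<in>S. P m = p m)"
proof -
  note S = submonoid_add[OF submonoid_S]
  have "\<forall>x. \<exists>s t. s \<in> S \<and> t \<in> S \<and> s - t = x"
  proof
    fix x
    obtain s t where "s \<in> S" "t \<in> S" "x = s - t" using differences[of x] by blast
    thus "\<exists>s t. s \<in> S \<and> t \<in> S \<and> s - t = x" by blast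
  qed
  then obtain s t where st: "\<And>x. s x \<in> S" "\<And>x. t x \<in> S" "\<And>x. s x - t x = x"
    unfolding choice_iff by blast
  have indep: "p (s x) - p (t x) = p u - p v" if "u \<in> S" "v \<in> S" "x = u - v" for x u v
  proof -
    have "s x + v = (s x - t x) + (t x + v)" by (simp add: add.assoc[symmetric])
    also have "s x - t x = u - v" unfolding st(3) by (fact that(3))
    also have "(u - v) + (t x + v) = u + t x" by (simp add: add.commute[of "t x"])
    finally have "s x + v = u + t x" .
    hence "p (s x + v) = p (u + t x)" by simp
    hence "p (s x) + p v = p u + p (t x)" using st that by (simp add: p)
    thus ?thesis by (simp add: algebra_simps)
  qed
  have "additive (\<lambda>x. p (s x) - p (t x))"
  proof
    fix x y
    have "(s x + s y) - (t x + t y) = (s x - t x) + (s y - t y)" by simp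
    hence "x + y = (s x + s y) - (t x + t y)" by (simp only: st(3))
    thus "p (s (x + y)) - p (t (x + y)) = p (s x) - p (t x) + (p (s y) - p (t y))"
      using indep[of "s x + s y" "t x + t y" "x + y"] S st(1,2) by (simp add: p algebra_simps)
  qed
  moreover have "p (s m) - p (t m) = p m" if "m \<in> S" for m
  proof -
    have "p 0 = 0" using p[of 0 0] submonoid_zero[OF submonoid_S] by simp
    thus ?thesis using indep[of m 0 m] submonoid_zero[OF submonoid_S] that by simp
  qed
  ultimately show ?thesis by blast
qed

text \<open>
  Finitely many degrees occur because an additive function that vanishes on the generators is
  zero: the degree of a nonzero part is visible in the image of one of the finitely many \<open>x\<^sup>g\<close>.
\<close>

lemma derivation_decomposition:
  fixes D :: "('m, 'k::field_char_0) operator"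
  assumes D: "D \<in> derivations S"
  shows "\<exists>A P. finite A \<and> D = (\<Sum>\<alpha>\<in>A. hom_der S \<alpha> (P \<alpha>)) \<and>
    (\<forall>\<alpha>\<in>A. additive (P \<alpha>) \<and> (\<exists>m\<in>S. P \<alpha> m \<noteq> 0) \<and> (\<forall>m\<in>S. P \<alpha> m \<noteq> 0 \<longrightarrow> m + \<alpha> \<in> S))"
proof -
  have "\<exists>P. additive P \<and> (\<forall>m\<in>S. P m = der_coeff D \<alpha> m)" for \<alpha>
    by (rule extend_additive) (rule der_coeff_add[OF D])
  then obtain P where P: "\<And>\<alpha>. additive (P \<alpha>)" "\<And>\<alpha> m. m \<in> S \<Longrightarrow> P \<alpha> m = der_coeff D \<alpha> m"
    by metis
  define A where "A = {\<alpha>. \<exists>m\<in>S. P \<alpha> m \<noteq> 0}"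
  have "A \<subseteq> (\<Union>g\<in>G. (\<lambda>k. k - g) ` keys (D (monom_x g)))"
  proof
    fix \<alpha> assume "\<alpha> \<in> A"
    then obtain g where g: "g \<in> G" "P \<alpha> g \<noteq> 0"
      using zero_on_G_imp_zero[OF P(1)[of \<alpha>]] by (auto simp: A_def)
    hence "g + \<alpha> \<in> keys (D (monom_x g))"
      using P(2)[of g \<alpha>] G_subset by (auto simp: in_keys_iff der_coeff_def)
    moreover have "\<alpha> = (g + \<alpha>) - g" by simp
    ultimately show "\<alpha> \<in> (\<Union>g\<in>G. (\<lambda>k. k - g) ` keys (D (monom_x g)))" using g(1) by blast
  qed
  hence A: "finite A" by (rule finite_subset) (use finite_G in simp)
  have stable: "m + \<alpha> \<in> S" if "m \<in> S" "P \<alpha> m \<noteq> 0" for \<alpha> m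
  proof -
    have "m + \<alpha> \<in> keys (D (monom_x m))" using that P(2) by (simp add: in_keys_iff der_coeff_def)
    moreover have "D (monom_x m) \<in> semigroup_algebra S"
      using that by (intro derivation_closed[OF D]) (simp add: semigroup_algebra_iff)
    ultimately show ?thesis by (auto simp: semigroup_algebra_iff)
  qed
  have "(\<Sum>\<alpha>\<in>A. hom_der S \<alpha> (P \<alpha>)) \<in> derivations S"
    using stable by (intro derivations_sum hom_der_derivation submonoid_S additive.add[OF P(1)])
  hence "D = (\<Sum>\<alpha>\<in>A. hom_der S \<alpha> (P \<alpha>))"
  proof (rule derivation_eqI_coeff[OF D])
    fix \<alpha> m assume m: "m \<in> S"
    show "der_coeff D \<alpha> m = der_coeff (\<Sum>\<alpha>\<in>A. hom_der S \<alpha> (P \<alpha>)) \<alpha> m"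
    proof (cases "\<alpha> \<in> A")
      case False
      hence "P \<alpha> m = 0" using m by (simp add: A_def)
      thus ?thesis using False m by (simp add: der_coeff_sum_hom_der[OF A m] P(2))
    qed (use m in \<open>simp add: der_coeff_sum_hom_der[OF A] P(2)\<close>)
  qed
  with A P(1) stable show ?thesis by (intro exI[of _ A] exI[of _ P]) (auto simp: A_def)
qed

text \<open>
  The case of a degree outside \<open>S\<close>. If a ray \<open>\<sigma>\<close> is negative at \<open>\<alpha>\<close>, translation by \<open>\<alpha>\<close> moves the
  facet \<open>\<sigma> = 0\<close> out of \<open>S\<close>, so \<open>p\<close> vanishes on it and is a nonzero multiple of \<open>\<sigma>\<close>. There is such
  a ray because \<open>\<alpha>\<close> is not in \<open>S\<close>, and just one because distinct rays are not proportional. Its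
  value at \<open>\<alpha>\<close> is \<open>-1\<close>: a point of \<open>S\<close> of height one over the facet is moved into \<open>S\<close>.
\<close>

lemma outer_degree_is_root:
  fixes p :: "'m \<Rightarrow> 'k::field_char_0"
  assumes p: "additive p" "m0 \<in> S" "p m0 \<noteq> 0" and "\<alpha> \<notin> S"
    and stable: "\<And>m. m \<in> S \<Longrightarrow> p m \<noteq> 0 \<Longrightarrow> m + \<alpha> \<in> S"
  shows "\<alpha> \<in> roots S" "\<exists>c. p = (\<lambda>m. c * of_int (root_ray S \<alpha> m))"
proof -
  have proportional: "\<exists>c. c \<noteq> 0 \<and> (\<forall>x. p x = c * of_int (\<sigma> x))" if \<sigma>: "\<sigma> \<in> dual_rays S" "\<sigma> \<alpha> < 0" for \<sigma>
  proof -
    have "p m = 0" if "m \<in> S" "\<sigma> m = 0" for m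
    proof (rule ccontr)
      assume "p m \<noteq> 0"
      hence "0 \<le> \<sigma> (m + \<alpha>)" using stable ray_nonneg[OF \<sigma>(1)] that by blast
      thus False using that \<sigma>(2) by (simp add: additive.add[OF ray_additive[OF \<sigma>(1)]])
    qed
    then obtain c where "\<forall>x. p x = c * of_int (\<sigma> x)" using ray_annihilator[OF \<sigma>(1) p(1)] by blast
    thus ?thesis using p(3) by auto
  qed
  obtain \<rho> where \<rho>: "\<rho> \<in> dual_rays S" "\<rho> \<alpha> < 0"
    using in_S_if_rays_nonneg[of \<alpha>] assms(4) by force
  obtain c where c: "c \<noteq> 0" "\<And>x. p x = c * of_int (\<rho> x)" using proportional[OF \<rho>] by blast
  have "0 \<le> \<sigma> \<alpha>" if \<sigma>: "\<sigma> \<in> dual_rays S - {\<rho>}" for \<sigma>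
  proof (rule ccontr)
    assume "\<not> 0 \<le> \<sigma> \<alpha>"
    then obtain d where "\<forall>x. p x = d * of_int (\<sigma> x)" using proportional[of \<sigma>] \<sigma> by auto
    hence "\<rho> = \<sigma>" using rays_proportional_eq[OF \<rho>(1) _ c(1), of \<sigma> d] \<sigma> c(2) by auto
    thus False using \<sigma> by simp
  qed
  moreover have "\<rho> \<alpha> = -1"
  proof -
    obtain m where m: "m \<in> S" "\<rho> m = 1" by (rule ray_height_one[OF \<rho>(1)])
    hence "0 \<le> \<rho> (m + \<alpha>)" using stable[of m] c ray_nonneg[OF \<rho>(1)] by simp
    thus ?thesis using m \<rho> by (simp add: additive.add[OF ray_additive[OF \<rho>(1)]])
  qed
  ultimately have root: "\<alpha> \<in> roots_of S \<rho>" by (simp add: roots_of_def)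
  thus "\<alpha> \<in> roots S" using \<rho>(1) by (auto simp: roots_def)
  have "p = (\<lambda>m. c * of_int (root_ray S \<alpha> m))"
    using c(2) root_ray_eq[OF \<rho>(1) root] by (intro ext) simp
  thus "\<exists>c. p = (\<lambda>m. c * of_int (root_ray S \<alpha> m))" by blast
qed

text \<open>
  Only \<open>\<rho>\<close> decreases under translation by \<open>\<alpha>\<close>, and it decreases by one from a positive value.
\<close>

lemma root_translate:
  assumes \<rho>: "\<rho> \<in> dual_rays S" and \<alpha>: "\<alpha> \<in> roots_of S \<rho>" and m: "m \<in> S" "\<rho> m \<noteq> 0"
  shows "m + \<alpha> \<in> S"
proof (rule in_S_if_rays_nonneg)
  fix \<sigma> assume \<sigma>: "\<sigma> \<in> dual_rays S"
  have "\<sigma> (m + \<alpha>) = \<sigma> m + \<sigma> \<alpha>" by (rule additive.add[OF ray_additive[OF \<sigma>]])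
  thus "0 \<le> \<sigma> (m + \<alpha>)"
    using \<alpha> m(2) ray_nonneg[OF \<sigma> m(1)] \<sigma> by (cases "\<sigma> = \<rho>") (auto simp: roots_of_def)
qed

lemma root_not_in_S: "\<alpha> \<in> roots S \<Longrightarrow> \<alpha> \<notin> S"
  using ray_nonneg by (force simp: roots_def roots_of_def)

end

section \<open>Sums of spaces of operators\<close>

lemma op_subspace_sum_of_spaces:
  fixes V :: "'i \<Rightarrow> ('m::ab_group_add, 'k::field_char_0) operator set"
  assumes "\<And>i. op_subspace (V i)"
  shows "op_subspace (sum_of_spaces A V)"
  unfolding op_subspace_def submonoid_def
proof (intro conjI ballI allI)
  show "0 \<in> sum_of_spaces A V" unfolding sum_of_spaces_def by (intro CollectI exI[of _ "{}"]) auto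
next
  fix D E assume "D \<in> sum_of_spaces A V" "E \<in> sum_of_spaces A V"
  then obtain F v F' v' where
    D: "D = sum v F" "finite F" "F \<subseteq> A" "\<forall>i\<in>F. v i \<in> V i" and
    E: "E = sum v' F'" "finite F'" "F' \<subseteq> A" "\<forall>i\<in>F'. v' i \<in> V i"
    unfolding sum_of_spaces_def by blast
  define w where "w i = (if i \<in> F then v i else 0)" for i
  define w' where "w' i = (if i \<in> F' then v' i else 0)" for i
  have "D = sum w (F \<union> F')" unfolding D(1) w_def using D(2) E(2)
    by (intro sum.mono_neutral_cong_left) auto
  moreover have "E = sum w' (F \<union> F')" unfolding E(1) w'_def using D(2) E(2)
    by (intro sum.mono_neutral_cong_left) auto
  ultimately have "D + E = (\<Sum>i\<in>F \<union> F'. w i + w' i)" by (simp add: sum.distrib)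
  moreover have "w i + w' i \<in> V i" for i
    using assms[of i] D(4) E(4) by (auto simp: w_def w'_def op_subspace_def submonoid_def)
  ultimately show "D + E \<in> sum_of_spaces A V"
    unfolding sum_of_spaces_def using D(2,3) E(2,3)
    by (intro CollectI exI[of _ "F \<union> F'"] exI[of _ "\<lambda>i. w i + w' i"]) auto
next
  fix c D assume "D \<in> sum_of_spaces A V"
  then obtain F v where
    D: "D = sum v F" "finite F" "F \<subseteq> A" "\<forall>i\<in>F. v i \<in> V i"
    unfolding sum_of_spaces_def by blast
  have "op_scale c D = (\<Sum>i\<in>F. op_scale c (v i))"
    by (rule ext) (simp add: D(1) op_scale_def sum_fun_apply scal_def sum_distrib_left)
  moreover have "op_scale c (v i) \<in> V i" if "i \<in> F" for i
    using assms[of i] D(4) that by (auto simp: op_subspace_def)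
  ultimately show "op_scale c D \<in> sum_of_spaces A V"
    unfolding sum_of_spaces_def using D(2,3)
    by (intro CollectI exI[of _ F] exI[of _ "\<lambda>i. op_scale c (v i)"]) auto
qed

lemma sum_of_spaces_hom_der:
  "sum_of_spaces A (\<lambda>\<alpha>. hom_der S \<alpha> ` P \<alpha>) =
     {\<Sum>\<alpha>\<in>F. hom_der S \<alpha> (p \<alpha>) | F p. finite F \<and> F \<subseteq> A \<and> (\<forall>\<alpha>\<in>F. p \<alpha> \<in> P \<alpha>)}"
proof (intro equalityI subsetI)
  fix D assume "D \<in> sum_of_spaces A (\<lambda>\<alpha>. hom_der S \<alpha> ` P \<alpha>)"
  then obtain F v where F: "D = sum v F" "finite F" "F \<subseteq> A" "\<forall>\<alpha>\<in>F. v \<alpha> \<in> hom_der S \<alpha> ` P \<alpha>"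
    unfolding sum_of_spaces_def by blast
  then obtain p where "\<forall>\<alpha>\<in>F. v \<alpha> = hom_der S \<alpha> (p \<alpha>) \<and> p \<alpha> \<in> P \<alpha>" unfolding image_iff by metis
  moreover from this have "D = (\<Sum>\<alpha>\<in>F. hom_der S \<alpha> (p \<alpha>))" unfolding F(1) by (intro sum.cong) auto
  ultimately show "D \<in> {\<Sum>\<alpha>\<in>F. hom_der S \<alpha> (p \<alpha>) | F p.
      finite F \<and> F \<subseteq> A \<and> (\<forall>\<alpha>\<in>F. p \<alpha> \<in> P \<alpha>)}" using F(2,3) by blast
next
  fix D assume "D \<in> {\<Sum>\<alpha>\<in>F. hom_der S \<alpha> (p \<alpha>) | F p.
      finite F \<and> F \<subseteq> A \<and> (\<forall>\<alpha>\<in>F. p \<alpha> \<in> P \<alpha>)}"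
  then obtain F p where "D = (\<Sum>\<alpha>\<in>F. hom_der S \<alpha> (p \<alpha>))" "finite F" "F \<subseteq> A" "\<forall>\<alpha>\<in>F. p \<alpha> \<in> P \<alpha>"
    by blast
  thus "D \<in> sum_of_spaces A (\<lambda>\<alpha>. hom_der S \<alpha> ` P \<alpha>)"
    unfolding sum_of_spaces_def
    by (intro CollectI exI[of _ F] exI[of _ "\<lambda>\<alpha>. hom_der S \<alpha> (p \<alpha>)"]) auto
qed

lemma g_space_eq:
  "(g_space S :: ('m::ab_group_add, 'k::field_char_0) operator set) = {\<Sum>\<alpha>\<in>F. hom_der S \<alpha> (p \<alpha>) | F p.
     finite F \<and> F \<subseteq> S \<and> (\<forall>\<alpha>\<in>F. p \<alpha> \<in> dual_lattice_over)}"
proof -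
  have "(g_comp S :: 'm \<Rightarrow> ('m, 'k) operator set) = (\<lambda>\<alpha>. hom_der S \<alpha> ` dual_lattice_over)"
    by (intro ext) (auto simp: g_comp_def)
  thus ?thesis unfolding g_space_def by (simp only: sum_of_spaces_hom_der)
qed

lemma sum_of_s_comp_eq:
  "(sum_of_spaces A (s_comp S) :: ('m::ab_group_add, 'k::field_char_0) operator set) =
     {\<Sum>\<alpha>\<in>F. hom_der S \<alpha> (\<lambda>m. c \<alpha> * of_int (root_ray S \<alpha> m)) | F c. finite F \<and> F \<subseteq> A}"
  (is "_ = ?R")
proof -
  have "(s_comp S :: 'm \<Rightarrow> ('m, 'k) operator set) = (\<lambda>\<alpha>. hom_der S \<alpha> ` {(\<lambda>m. c * of_int (root_ray S \<alpha> m)) | c. True})"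
    by (intro ext) (auto simp: s_comp_def)
  hence "(sum_of_spaces A (s_comp S) :: ('m, 'k) operator set) = {\<Sum>\<alpha>\<in>F. hom_der S \<alpha> (p \<alpha>) | F p. finite F \<and> F \<subseteq> A \<and>
      (\<forall>\<alpha>\<in>F. \<exists>c. p \<alpha> = (\<lambda>m. c * of_int (root_ray S \<alpha> m)))}" (is "_ = ?L")
    by (simp only: sum_of_spaces_hom_der) simp
  also have "?L = ?R"
  proof (intro equalityI subsetI)
    fix D assume "D \<in> ?L"
    then obtain F p where F: "D = (\<Sum>\<alpha>\<in>F. hom_der S \<alpha> (p \<alpha>))" "finite F" "F \<subseteq> A"
      "\<forall>\<alpha>\<in>F. \<exists>c. p \<alpha> = (\<lambda>m. c * of_int (root_ray S \<alpha> m))" by blast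
    then obtain c where "\<forall>\<alpha>\<in>F. p \<alpha> = (\<lambda>m. c \<alpha> * of_int (root_ray S \<alpha> m))" by metis
    hence "D = (\<Sum>\<alpha>\<in>F. hom_der S \<alpha> (\<lambda>m. c \<alpha> * of_int (root_ray S \<alpha> m)))"
      unfolding F(1) by (intro sum.cong) auto
    thus "D \<in> ?R" using F(2,3) by blast
  next
    fix D assume "D \<in> ?R"
    then obtain F c where "D = (\<Sum>\<alpha>\<in>F. hom_der S \<alpha> (\<lambda>m. c \<alpha> * of_int (root_ray S \<alpha> m)))"
      "finite F" "F \<subseteq> A" by blast
    thus "D \<in> ?L"
      by (intro CollectI exI[of _ F] exI[of _ "\<lambda>\<alpha> m. c \<alpha> * of_int (root_ray S \<alpha> m)"]) auto
  qed
  finally show ?thesis .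
qed

section \<open>Operators that preserve a monomial ideal\<close>

text \<open>
  The ideal is given by the set \<open>E\<close> of its exponents. The image of \<open>x\<^sup>m\<close> has the terms
  \<open>p\<^sub>\<alpha>(m) x\<^bsup>m+\<alpha>\<^esup>\<close> in pairwise different degrees, so no cancellation can take place.
\<close>

lemma sum_hom_der_preserves_iff:
  fixes p :: "'m::ab_group_add \<Rightarrow> 'm \<Rightarrow> 'k::field_char_0"
  assumes "finite F" "E \<subseteq> S"
  shows "(\<Sum>\<alpha>\<in>F. hom_der S \<alpha> (p \<alpha>)) ` {f. keys f \<subseteq> E} \<subseteq> {f. keys f \<subseteq> E} \<longleftrightarrow>
    (\<forall>\<alpha>\<in>F. \<forall>m\<in>E. p \<alpha> m \<noteq> 0 \<longrightarrow> m + \<alpha> \<in> E)" (is "?D ` ?I \<subseteq> ?I \<longleftrightarrow> ?R")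
proof
  assume *: "?D ` ?I \<subseteq> ?I"
  show ?R
  proof (intro ballI impI)
    fix \<alpha> m assume \<alpha>: "\<alpha> \<in> F" and m: "m \<in> E" "p \<alpha> m \<noteq> 0"
    have "monom_x m \<in> ?I" using m by auto
    hence "?D (monom_x m) \<in> ?I" using * by blast
    moreover have "der_coeff ?D \<alpha> m = p \<alpha> m"
      using assms m \<alpha> by (subst der_coeff_sum_hom_der) auto
    hence "m + \<alpha> \<in> keys (?D (monom_x m))" using m by (simp add: der_coeff_def in_keys_iff)
    ultimately show "m + \<alpha> \<in> E" by auto
  qed
next
  assume R: ?R
  have "keys (?D f) \<subseteq> E" if "keys f \<subseteq> E" for f
    unfolding sum_fun_apply using R assms(2) that
    by (intro keys_sum_subset keys_hom_der[of E]) auto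
  thus "?D ` ?I \<subseteq> ?I" by auto
qed

context saturated_semigroup
begin

lemma s_space_derivation:
  assumes "finite F" "F \<subseteq> roots S"
  shows "(\<Sum>\<alpha>\<in>F. hom_der S \<alpha> (\<lambda>m. c \<alpha> * of_int (root_ray S \<alpha> m)) :: ('m, 'k::field_char_0) operator)
           \<in> derivations S"
proof (rule derivations_sum, rule hom_der_derivation[OF submonoid_S])
  fix \<alpha> assume "\<alpha> \<in> F"
  then obtain \<rho> where \<rho>: "\<rho> \<in> dual_rays S" "\<alpha> \<in> roots_of S \<rho>" "root_ray S \<alpha> = \<rho>"
    using assms(2) root_ray_eq by (fastforce simp: roots_def)
  show "c \<alpha> * of_int (root_ray S \<alpha> (x + y)) =
      c \<alpha> * of_int (root_ray S \<alpha> x) + c \<alpha> * of_int (root_ray S \<alpha> y)" for x y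
    by (simp add: \<rho>(3) additive.add[OF ray_additive[OF \<rho>(1)]] distrib_left)
  show "m + \<alpha> \<in> S" if "m \<in> S" "c \<alpha> * of_int (root_ray S \<alpha> m) \<noteq> 0" for m
    using that \<rho> by (intro root_translate[OF \<rho>(1,2)]) auto
qed

lemma g_space_derivation:
  assumes "F \<subseteq> S" "\<And>\<alpha>. \<alpha> \<in> F \<Longrightarrow> p \<alpha> \<in> dual_lattice_over"
  shows "(\<Sum>\<alpha>\<in>F. hom_der S \<alpha> (p \<alpha>)) \<in> derivations S"
proof (rule derivations_sum, rule hom_der_derivation[OF submonoid_S])
  fix \<alpha> assume \<alpha>: "\<alpha> \<in> F"
  show "p \<alpha> (x + y) = p \<alpha> x + p \<alpha> y" for x y
    by (rule additive.add[OF dual_lattice_over_imp_additive[OF assms(2)[OF \<alpha>]]])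
  show "m + \<alpha> \<in> S" if "m \<in> S" for m
    using that \<alpha> assms(1) submonoid_add[OF submonoid_S] by blast
qed

text \<open>
  A common element has no part in a degree outside \<open>S\<close>, being in \<open>g\<close>, and none in a degree inside
  \<open>S\<close>, being in \<open>s\<close>.
\<close>

lemma g_space_int_s_space: "g_space S \<inter> s_space S = {0 :: ('m, 'k::field_char_0) operator}"
proof
  show "{0} \<subseteq> g_space S \<inter> (s_space S :: ('m, 'k) operator set)"
    unfolding g_space_eq s_space_def sum_of_s_comp_eq by (intro subsetI IntI CollectI exI[of _ "{}"]) auto
  show "g_space S \<inter> s_space S \<subseteq> {0 :: ('m, 'k) operator}"
  proof
    fix D :: "('m, 'k) operator" assume "D \<in> g_space S \<inter> s_space S"
    then obtain F p F' c where
      D: "D = (\<Sum>\<alpha>\<in>F. hom_der S \<alpha> (p \<alpha>))" "finite F" "F \<subseteq> S" "\<forall>\<alpha>\<in>F. p \<alpha> \<in> dual_lattice_over" and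
      D': "D = (\<Sum>\<alpha>\<in>F'. hom_der S \<alpha> (\<lambda>m. c \<alpha> * of_int (root_ray S \<alpha> m)))" "finite F'" "F' \<subseteq> roots S"
      unfolding g_space_eq s_space_def sum_of_s_comp_eq by blast
    have "D \<in> derivations S" unfolding D(1) using D by (intro g_space_derivation) auto
    moreover have "der_coeff D \<alpha> m = 0" if "m \<in> S" for \<alpha> m
    proof (cases "\<alpha> \<in> S")
      case True
      hence "\<alpha> \<notin> F'" using D'(3) root_not_in_S by blast
      thus ?thesis unfolding D'(1) using that by (simp add: der_coeff_sum_hom_der[OF D'(2)])
    next
      case False
      hence "\<alpha> \<notin> F" using D(3) by blast
      thus ?thesis unfolding D(1) using that by (simp add: der_coeff_sum_hom_der[OF D(2)])
    qed
    ultimately have "D = 0"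
      by (intro derivation_eqI_coeff[OF _ derivations_zero]) (auto simp: der_coeff_def)
    thus "D \<in> {0}" by simp
  qed
qed

text \<open>
  The point is that stability under a root \<open>\<alpha>\<close> of \<open>\<rho>\<close> can be tested on generators. Let \<open>m = a i + s\<close>
  with \<open>\<rho> m \<noteq> 0\<close>. If \<open>\<rho> (a i) \<noteq> 0\<close>, then \<open>a i + \<alpha>\<close> is an exponent of the ideal by
  assumption. If \<open>\<rho> (a i) = 0\<close>, then \<open>\<rho> s \<noteq> 0\<close>, so that \<open>s + \<alpha>\<close> is in \<open>S\<close>, and
  \<open>m + \<alpha> = a i + (s + \<alpha>)\<close>.
\<close>

lemma s_space_ideal_eq:
  fixes I :: "('m \<Rightarrow>\<^sub>0 'k::field_char_0) set"
  assumes a: "\<forall>i\<in>{1..l}. a i \<in> S" and I: "I = monomial_ideal S l a"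
  shows "s_space_ideal S I = sum_of_spaces (roots_ideal S l a I) (s_comp S)"
proof -
  define E where "E = {a i + s | i s. i \<in> {1..l} \<and> s \<in> S}"
  have IE: "I = {f. keys f \<subseteq> E}"
    using monomial_ideal_iff[OF submonoid_S a] by (auto simp: I E_def)
  have ES: "E \<subseteq> S" using a submonoid_add[OF submonoid_S] by (auto simp: E_def)
  have gens: "a i \<in> E" if "i \<in> {1..l}" for i
    using that submonoid_zero[OF submonoid_S] unfolding E_def
    by (intro CollectI exI[of _ i] exI[of _ 0]) simp
  have supp: "supp S I = E" using ES by (auto simp: supp_def IE)
  have sub: "roots_ideal S l a I \<subseteq> roots S"
    by (auto simp: roots_ideal_def roots_of_ideal_def roots_def)
  have root: "(\<forall>m\<in>E. root_ray S \<alpha> m \<noteq> 0 \<longrightarrow> m + \<alpha> \<in> E) \<longleftrightarrow> \<alpha> \<in> roots_ideal S l a I"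
    if \<alpha>: "\<alpha> \<in> roots S" for \<alpha>
  proof -
    obtain \<rho> where \<rho>: "\<rho> \<in> dual_rays S" "\<alpha> \<in> roots_of S \<rho>"
      using \<alpha> by (auto simp: roots_def)
    have rr: "root_ray S \<alpha> = \<rho>" by (rule root_ray_eq[OF \<rho>])
    have uniq: "\<rho>' = \<rho>" if "\<rho>' \<in> dual_rays S" "\<alpha> \<in> roots_of S \<rho>'" for \<rho>'
      using root_ray_eq[OF that] rr by simp
    have "\<alpha> \<in> roots_ideal S l a I \<longleftrightarrow> (\<forall>i\<in>{1..l}. \<rho> (a i) \<noteq> 0 \<longrightarrow> a i + \<alpha> \<in> E)"
    proof -
      have "\<alpha> \<in> roots_ideal S l a I \<longleftrightarrow> \<alpha> \<in> roots_of_ideal S l a I \<rho>"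
        using \<rho>(1) uniq unfolding roots_ideal_def roots_of_ideal_def by blast
      thus ?thesis using \<rho>(2) by (simp add: roots_of_ideal_def supp perp_def)
    qed
    also have "\<dots> \<longleftrightarrow> (\<forall>m\<in>E. \<rho> m \<noteq> 0 \<longrightarrow> m + \<alpha> \<in> E)"
    proof (intro iffI ballI impI)
      fix m assume *: "\<forall>i\<in>{1..l}. \<rho> (a i) \<noteq> 0 \<longrightarrow> a i + \<alpha> \<in> E" and m: "m \<in> E" "\<rho> m \<noteq> 0"
      obtain i s where is': "i \<in> {1..l}" "s \<in> S" "m = a i + s" using m(1) unfolding E_def by blast
      show "m + \<alpha> \<in> E"
      proof (cases "\<rho> (a i) = 0")
        case True
        hence "\<rho> s \<noteq> 0" using m is' by (simp add: additive.add[OF ray_additive[OF \<rho>(1)]])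
        hence "s + \<alpha> \<in> S" by (rule root_translate[OF \<rho> is'(2)])
        thus ?thesis using is'(1,3) unfolding E_def
          by (intro CollectI exI[of _ i] exI[of _ "s + \<alpha>"]) (simp add: add_ac)
      next
        case False
        then obtain j t where "j \<in> {1..l}" "t \<in> S" "a i + \<alpha> = a j + t"
          using * is'(1) unfolding E_def by blast
        moreover have "m + \<alpha> = (a i + \<alpha>) + s" using is' by (simp add: add_ac)
        ultimately show ?thesis using is'(2) submonoid_add[OF submonoid_S] unfolding E_def
          by (intro CollectI exI[of _ j] exI[of _ "t + s"]) (auto simp: add_ac)
      qed
    qed (use gens in auto)
    finally show ?thesis by (simp add: rr)
  qed
  show ?thesis
  proof (intro equalityI subsetI)
    fix D assume "D \<in> s_space_ideal S I"
    then obtain F c where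
      D: "D = (\<Sum>\<alpha>\<in>F. hom_der S \<alpha> (\<lambda>m. c \<alpha> * of_int (root_ray S \<alpha> m)))" "finite F" "F \<subseteq> roots S"
      and DI: "D ` I \<subseteq> I"
      unfolding s_space_ideal_def s_space_def sum_of_s_comp_eq by blast
    \<comment> \<open>Vanishing summands carry no information on their degree and are dropped.\<close>
    define F' where "F' = {\<alpha> \<in> F. c \<alpha> \<noteq> 0}"
    have "D = (\<Sum>\<alpha>\<in>F'. hom_der S \<alpha> (\<lambda>m. c \<alpha> * of_int (root_ray S \<alpha> m)))"
      unfolding D(1) F'_def using D(2)
      by (intro sum.mono_neutral_right) (auto intro!: hom_der_cong_zero)
    moreover have "F' \<subseteq> roots_ideal S l a I"
    proof
      fix \<alpha> assume \<alpha>: "\<alpha> \<in> F'"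
      have "\<forall>\<alpha>\<in>F. \<forall>m\<in>E. c \<alpha> * of_int (root_ray S \<alpha> m) \<noteq> 0 \<longrightarrow> m + \<alpha> \<in> E"
        using DI unfolding D(1) IE sum_hom_der_preserves_iff[OF D(2) ES] .
      hence "\<forall>m\<in>E. root_ray S \<alpha> m \<noteq> 0 \<longrightarrow> m + \<alpha> \<in> E" using \<alpha> by (auto simp: F'_def)
      moreover have "\<alpha> \<in> roots S" using \<alpha> D(3) by (auto simp: F'_def)
      ultimately show "\<alpha> \<in> roots_ideal S l a I" using root by blast
    qed
    moreover have "finite F'" using D(2) by (simp add: F'_def)
    ultimately show "D \<in> sum_of_spaces (roots_ideal S l a I) (s_comp S)"
      unfolding sum_of_s_comp_eq by blast
  next
    fix D :: "('m, 'k) operator" assume "D \<in> sum_of_spaces (roots_ideal S l a I) (s_comp S)"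
    then obtain F c where
      D: "D = (\<Sum>\<alpha>\<in>F. hom_der S \<alpha> (\<lambda>m. c \<alpha> * of_int (root_ray S \<alpha> m)))" "finite F"
        "F \<subseteq> roots_ideal S l a I"
      unfolding sum_of_s_comp_eq by blast
    have "\<forall>\<alpha>\<in>F. \<forall>m\<in>E. c \<alpha> * of_int (root_ray S \<alpha> m) \<noteq> 0 \<longrightarrow> m + \<alpha> \<in> E"
      using D(3) root sub by (auto simp: subset_iff)
    hence "D ` I \<subseteq> I" unfolding D(1) IE sum_hom_der_preserves_iff[OF D(2) ES] .
    moreover have "D \<in> s_space S"
      unfolding s_space_def sum_of_s_comp_eq using D sub by blast
    ultimately show "D \<in> s_space_ideal S I" by (simp add: s_space_ideal_def)
  qed
qed

text \<open>
  The parts of a derivation with degrees in \<open>S\<close> form an element of \<open>g\<close>, the others an element of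
  \<open>s\<close>. Since all parts preserve the ideal together with the derivation, the second one lies
  in \<open>s(I)\<close>.
\<close>

lemma derivations_ideal_eq:
  fixes I :: "('m \<Rightarrow>\<^sub>0 'k::field_char_0) set"
  assumes a: "\<forall>i\<in>{1..l}. a i \<in> S" and I: "I = monomial_ideal S l a"
    and over: "\<And>p :: 'm \<Rightarrow> 'k. additive p \<Longrightarrow> p \<in> dual_lattice_over"
  shows "derivations_ideal S I = {D + E | D E. D \<in> g_space S \<and> E \<in> s_space_ideal S I}"
proof -
  define E where "E = {a i + s | i s. i \<in> {1..l} \<and> s \<in> S}"
  have IE: "I = {f. keys f \<subseteq> E}"
    using monomial_ideal_iff[OF submonoid_S a] by (auto simp: I E_def)
  have ES: "E \<subseteq> S" using a submonoid_add[OF submonoid_S] by (auto simp: E_def)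
  have SE: "m + \<alpha> \<in> E" if m: "m \<in> E" and \<alpha>: "\<alpha> \<in> S" for m \<alpha>
  proof -
    obtain i s where "i \<in> {1..l}" "s \<in> S" "m = a i + s" using m unfolding E_def by blast
    thus ?thesis using \<alpha> submonoid_add[OF submonoid_S] unfolding E_def
      by (intro CollectI exI[of _ i] exI[of _ "s + \<alpha>"]) (auto simp: add_ac)
  qed
  have g_preserves: "D ` I \<subseteq> I" if D: "D \<in> g_space S" for D :: "('m, 'k) operator"
  proof -
    obtain F p where F: "D = (\<Sum>\<alpha>\<in>F. hom_der S \<alpha> (p \<alpha>))" "finite F" "F \<subseteq> S"
      using D unfolding g_space_eq by blast
    show ?thesis unfolding F(1) IE sum_hom_der_preserves_iff[OF F(2) ES] using F(3) SE by blast
  qed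
  show ?thesis
  proof (intro equalityI subsetI)
    fix D assume "D \<in> derivations_ideal S I"
    hence D: "D \<in> derivations S" and DI: "D ` I \<subseteq> I" by (auto simp: derivations_ideal_def)
    obtain A P where A: "finite A" "D = (\<Sum>\<alpha>\<in>A. hom_der S \<alpha> (P \<alpha>))"
      and P: "\<forall>\<alpha>\<in>A. additive (P \<alpha>) \<and> (\<exists>m\<in>S. P \<alpha> m \<noteq> 0) \<and> (\<forall>m\<in>S. P \<alpha> m \<noteq> 0 \<longrightarrow> m + \<alpha> \<in> S)"
      using derivation_decomposition[OF D] by blast
    define D1 where "D1 = (\<Sum>\<alpha>\<in>A \<inter> S. hom_der S \<alpha> (P \<alpha>))"
    define D2 where "D2 = (\<Sum>\<alpha>\<in>A - S. hom_der S \<alpha> (P \<alpha>))"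
    have "D = D1 + D2"
      unfolding A(2) D1_def D2_def using A(1) by (simp add: sum.Int_Diff)
    have "D1 \<in> g_space S"
      unfolding g_space_eq D1_def using A P over by (intro CollectI exI[of _ "A \<inter> S"] exI[of _ P]) auto
    have outer: "\<alpha> \<in> roots S \<and> (\<exists>c. P \<alpha> = (\<lambda>m. c * of_int (root_ray S \<alpha> m)))" if \<alpha>: "\<alpha> \<in> A - S" for \<alpha>
    proof -
      obtain m0 where "additive (P \<alpha>)" "m0 \<in> S" "P \<alpha> m0 \<noteq> 0" "\<alpha> \<notin> S"
        "\<And>m. m \<in> S \<Longrightarrow> P \<alpha> m \<noteq> 0 \<Longrightarrow> m + \<alpha> \<in> S"
        using P \<alpha> by blast
      from outer_degree_is_root[OF this] show ?thesis by blast
    qed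
    then obtain c where c: "\<And>\<alpha>. \<alpha> \<in> A - S \<Longrightarrow> P \<alpha> = (\<lambda>m. c \<alpha> * of_int (root_ray S \<alpha> m))"
      by metis
    have "D2 = (\<Sum>\<alpha>\<in>A - S. hom_der S \<alpha> (\<lambda>m. c \<alpha> * of_int (root_ray S \<alpha> m)))"
      unfolding D2_def by (intro sum.cong refl) (simp only: c)
    moreover have "finite (A - S)" "A - S \<subseteq> roots S" using A(1) outer by auto
    ultimately have "D2 \<in> s_space S" unfolding s_space_def sum_of_s_comp_eq by blast
    moreover have "D2 ` I \<subseteq> I"
    proof -
      have "\<forall>\<alpha>\<in>A. \<forall>m\<in>E. P \<alpha> m \<noteq> 0 \<longrightarrow> m + \<alpha> \<in> E"
        using DI unfolding A(2) IE sum_hom_der_preserves_iff[OF A(1) ES] .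
      moreover have "finite (A - S)" using A(1) by simp
      ultimately show ?thesis
        unfolding D2_def IE by (subst sum_hom_der_preserves_iff[OF _ ES]) auto
    qed
    ultimately have "D2 \<in> s_space_ideal S I" by (simp add: s_space_ideal_def)
    with \<open>D = D1 + D2\<close> \<open>D1 \<in> g_space S\<close>
    show "D \<in> {D + E | D E. D \<in> g_space S \<and> E \<in> s_space_ideal S I}" by blast
  next
    fix X assume "X \<in> {D + E | D E. D \<in> g_space S \<and> E \<in> s_space_ideal S I}"
    then obtain D1 D2 where X: "X = D1 + D2" "D1 \<in> g_space S" "D2 \<in> s_space S" "D2 ` I \<subseteq> I"
      by (auto simp: s_space_ideal_def)
    have "D1 \<in> derivations S" using X(2) g_space_derivation unfolding g_space_eq by blast
    moreover have "D2 \<in> derivations S"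
      using X(3) s_space_derivation unfolding s_space_def sum_of_s_comp_eq by blast
    moreover have "X f \<in> I" if "f \<in> I" for f
    proof -
      have "D1 f \<in> I" "D2 f \<in> I" using that X(4) g_preserves[OF X(2)] by auto
      thus ?thesis by (simp add: X(1) IE keys_add_subset)
    qed
    ultimately show "X \<in> derivations_ideal S I"
      by (auto simp: derivations_ideal_def X(1) derivations_add)
  qed
qed

end

section \<open>The decomposition of the derivations that preserve a monomial ideal\<close>

theorem proposition1p4:
  fixes n l :: nat
    and \<iota> :: "'m::ab_group_add \<Rightarrow> 'v::real_vector"
    and S :: "'m set"
    and a :: "nat \<Rightarrow> 'm"
    and I :: "('m \<Rightarrow>\<^sub>0 'k::field_char_0) set"
  assumes "lattice_embedding n \<iota>"
    and "affine_semigroup S" and "minimally_embedded S"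
    and "saturated \<iota> S" and "pointed \<iota> S"
    and "\<forall>i\<in>{1..l}. a i \<in> S"
    and "I = monomial_ideal S l a"
  shows "is_direct_sum (s_space_ideal S I) (roots_ideal S l a I) (s_comp S)
       \<and> is_direct_sum2 (derivations_ideal S I) (g_space S) (s_space_ideal S I)"
proof -
  obtain G where "saturated_semigroup S G" using saturated_semigroupI assms(1-4) by blast
  then interpret saturated_semigroup S G .
  note s_eq = s_space_ideal_eq[OF assms(6,7)]
  have "is_direct_sum (s_space_ideal S I) (roots_ideal S l a I) (s_comp S)"
    unfolding s_eq
    by (rule direct_if_homogeneous[OF op_subspace_s_comp]) (auto simp: s_comp_def)
  moreover have "is_direct_sum2 (derivations_ideal S I) (g_space S) (s_space_ideal S I)"
    unfolding is_direct_sum2_def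
  proof (intro conjI)
    show "op_subspace (g_space S :: ('m, 'k) operator set)"
      unfolding g_space_def by (rule op_subspace_sum_of_spaces[OF op_subspace_g_comp])
    show s: "op_subspace (s_space_ideal S I)"
      unfolding s_eq by (rule op_subspace_sum_of_spaces[OF op_subspace_s_comp])
    show "derivations_ideal S I = {D + E | D E. D \<in> g_space S \<and> E \<in> s_space_ideal S I}"
      by (rule derivations_ideal_eq[OF assms(6,7)])
        (rule lattice_embedding_additive_in_dual_lattice_over[OF assms(1)])
    have "0 \<in> s_space_ideal S I" using s by (simp add: op_subspace_def submonoid_def)
    thus "g_space S \<inter> s_space_ideal S I = {0}"
      using g_space_int_s_space by (auto simp: s_space_ideal_def)
  qed
  ultimately show ?thesis ..
qed

end
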